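(* Let $p\in(0,\infty)$ with $p\neq2$, let $\mathfrak N$ be a $\mathrm{II}_1$ factor, and let $\psi$ be a surjective $L^p$-isometry on $\mathscr U(\mathfrak N)$ such that $\psi(e^{i\theta}U)=e^{i\theta}U$ for every self-adjoint unitary $U\in\mathfrak N$ and every $\theta\in\mathbb R$. Then $\psi(e^{i\theta}UV)=e^{i\theta}UV$ for all self-adjoint unitaries $U,V\in\mathfrak N$ and every $\theta\in\mathbb R$.
   Context: $\mathscr U(\mathfrak N)$ is the unitary group of $\mathfrak N$; with $\tau$ the tracial state of $\mathfrak N$, $\|A\|_p:=\tau(|A|^p)^{1/p}$. A map $\psi:\mathscr U(\mathfrak N)\to\mathscr U(\mathfrak N)$ is an $L^p$-isometry if $\|U-V\|_p=\|\psi(U)-\psi(V)\|_p$ for all $U,V\in\mathscr U(\mathfrak N)$. *)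

theory Defs
  imports "HOL-Analysis.Analysis" "HOL-Computational_Algebra.Polynomial"
begin

text \<open>Complex Hilbert spaces. The inner product is linear in its first argument; the axiom
  \<open>norm_cinner\<close> makes it positive definite, and completeness is inherited from \<open>banach\<close>.\<close>

class chilbert_space = banach +
  fixes scaleC :: "complex \<Rightarrow> 'a \<Rightarrow> 'a" (infixr "*\<^sub>C" 75)
    and cinner :: "'a \<Rightarrow> 'a \<Rightarrow> complex"
  assumes scaleC_add_right: "c *\<^sub>C (x + y) = c *\<^sub>C x + c *\<^sub>C y"
    and scaleC_add_left: "(c + d) *\<^sub>C x = c *\<^sub>C x + d *\<^sub>C x"
    and scaleC_scaleC: "c *\<^sub>C d *\<^sub>C x = (c * d) *\<^sub>C x"
    and scaleR_scaleC: "r *\<^sub>R x = complex_of_real r *\<^sub>C x"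
    and cinner_commute: "cinner x y = cnj (cinner y x)"
    and cinner_add_left: "cinner (x + y) z = cinner x z + cinner y z"
    and cinner_scaleC_left: "cinner (c *\<^sub>C x) y = c * cinner x y"
    and norm_cinner: "cinner x x = complex_of_real ((norm x)\<^sup>2)"

lemma norm_scaleC: "norm (c *\<^sub>C x) = cmod c * norm (x :: 'h::chilbert_space)"
proof -
  have "cinner (c *\<^sub>C x) (c *\<^sub>C x) = c * cnj (cinner (c *\<^sub>C x) x)"
    by (metis cinner_commute cinner_scaleC_left)
  also have "\<dots> = (c * cnj c) * cnj (cinner x x)"
    by (simp add: cinner_scaleC_left)
  also have "\<dots> = complex_of_real ((cmod c * norm x)\<^sup>2)"
    by (simp add: norm_cinner power_mult_distrib flip: complex_norm_square)
  finally have "(norm (c *\<^sub>C x))\<^sup>2 = (cmod c * norm x)\<^sup>2"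
    by (simp only: norm_cinner of_real_eq_iff)
  then show ?thesis
    by (simp add: power2_eq_iff_nonneg)
qed

text \<open>Bounded operators are those real bounded linear maps that commute with complex scalars.
  The operator \<open>c A\<close> is written \<open>scalar_op c o\<^sub>L A\<close>.\<close>

definition bounded_ops :: "('h::chilbert_space \<Rightarrow>\<^sub>L 'h) set" where
  "bounded_ops = {A. \<forall>c x. blinfun_apply A (c *\<^sub>C x) = c *\<^sub>C blinfun_apply A x}"

lift_definition scalar_op :: "complex \<Rightarrow> ('h::chilbert_space \<Rightarrow>\<^sub>L 'h)" is "\<lambda>c x. c *\<^sub>C x"
proof
  fix c :: complex and x y :: 'h and r :: real
  show "c *\<^sub>C (x + y) = c *\<^sub>C x + c *\<^sub>C y"
    by (rule scaleC_add_right)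
  show "c *\<^sub>C r *\<^sub>R x = r *\<^sub>R c *\<^sub>C x"
    by (simp add: scaleR_scaleC scaleC_scaleC mult.commute)
  show "\<exists>K. \<forall>x::'h. norm (c *\<^sub>C x) \<le> norm x * K"
    by (intro exI[of _ "cmod c"]) (simp add: norm_scaleC mult.commute)
qed

definition cadjoint :: "('h::chilbert_space \<Rightarrow>\<^sub>L 'h) \<Rightarrow> ('h \<Rightarrow>\<^sub>L 'h)" where
  "cadjoint A = (THE B. \<forall>x y. cinner (blinfun_apply A x) y = cinner x (blinfun_apply B y))"

definition commutant :: "('h::chilbert_space \<Rightarrow>\<^sub>L 'h) set \<Rightarrow> ('h \<Rightarrow>\<^sub>L 'h) set" where
  "commutant S = {B \<in> bounded_ops. \<forall>A\<in>S. A o\<^sub>L B = B o\<^sub>L A}"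

definition von_neumann_algebra :: "('h::chilbert_space \<Rightarrow>\<^sub>L 'h) set \<Rightarrow> bool" where
  "von_neumann_algebra N \<longleftrightarrow>
     N \<subseteq> bounded_ops \<and> (\<forall>A\<in>N. cadjoint A \<in> N) \<and> commutant (commutant N) = N"

text \<open>The clause \<open>id_blinfun \<noteq> 0\<close> excludes the zero Hilbert space.\<close>

definition vn_factor :: "('h::chilbert_space \<Rightarrow>\<^sub>L 'h) set \<Rightarrow> bool" where
  "vn_factor N \<longleftrightarrow>
     von_neumann_algebra N \<and> N \<inter> commutant N = range scalar_op \<and>
     (id_blinfun :: 'h \<Rightarrow>\<^sub>L 'h) \<noteq> 0"

definition projections :: "('h::chilbert_space \<Rightarrow>\<^sub>L 'h) set \<Rightarrow> ('h \<Rightarrow>\<^sub>L 'h) set" where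
  "projections N = {E \<in> N. E o\<^sub>L E = E \<and> cadjoint E = E}"

text \<open>Murray--von Neumann equivalence.\<close>

definition mvn_equiv ::
  "('h::chilbert_space \<Rightarrow>\<^sub>L 'h) set \<Rightarrow> ('h \<Rightarrow>\<^sub>L 'h) \<Rightarrow> ('h \<Rightarrow>\<^sub>L 'h) \<Rightarrow> bool" where
  "mvn_equiv N E F \<longleftrightarrow> (\<exists>V\<in>N. cadjoint V o\<^sub>L V = E \<and> V o\<^sub>L cadjoint V = F)"

definition finite_projection ::
  "('h::chilbert_space \<Rightarrow>\<^sub>L 'h) set \<Rightarrow> ('h \<Rightarrow>\<^sub>L 'h) \<Rightarrow> bool" where
  "finite_projection N E \<longleftrightarrow>
     E \<in> projections N \<and>
     (\<forall>F\<in>projections N. E o\<^sub>L F = F \<and> mvn_equiv N E F \<longrightarrow> F = E)"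

definition abelian_projection ::
  "('h::chilbert_space \<Rightarrow>\<^sub>L 'h) set \<Rightarrow> ('h \<Rightarrow>\<^sub>L 'h) \<Rightarrow> bool" where
  "abelian_projection N E \<longleftrightarrow>
     E \<in> projections N \<and>
     (\<forall>A\<in>N. \<forall>B\<in>N. (E o\<^sub>L A o\<^sub>L E) o\<^sub>L (E o\<^sub>L B o\<^sub>L E) = (E o\<^sub>L B o\<^sub>L E) o\<^sub>L (E o\<^sub>L A o\<^sub>L E))"

definition II1_factor :: "('h::chilbert_space \<Rightarrow>\<^sub>L 'h) set \<Rightarrow> bool" where
  "II1_factor N \<longleftrightarrow>
     vn_factor N \<and> finite_projection N id_blinfun \<and>
     (\<forall>E. abelian_projection N E \<longrightarrow> E = 0)"

text \<open>\<open>\<tau>\<close> restricted to \<open>N\<close>; its values outside \<open>N\<close> are irrelevant. On a II-1 factor the tracial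
  state exists, is unique, and is automatically faithful (and normal).\<close>

definition faithful_tracial_state ::
  "('h::chilbert_space \<Rightarrow>\<^sub>L 'h) set \<Rightarrow> (('h \<Rightarrow>\<^sub>L 'h) \<Rightarrow> complex) \<Rightarrow> bool" where
  "faithful_tracial_state N \<tau> \<longleftrightarrow>
     (\<forall>A\<in>N. \<forall>B\<in>N. \<tau> (A + B) = \<tau> A + \<tau> B) \<and>
     (\<forall>c. \<forall>A\<in>N. \<tau> (scalar_op c o\<^sub>L A) = c * \<tau> A) \<and>
     (\<forall>A\<in>N. \<tau> (cadjoint A o\<^sub>L A) \<in> \<real>\<^sub>\<ge>\<^sub>0) \<and>
     \<tau> id_blinfun = 1 \<and>
     (\<forall>A\<in>N. \<forall>B\<in>N. \<tau> (A o\<^sub>L B) = \<tau> (B o\<^sub>L A)) \<and>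
     (\<forall>A\<in>N. \<tau> (cadjoint A o\<^sub>L A) = 0 \<longrightarrow> A = 0)"

definition op_spectrum :: "('h::chilbert_space \<Rightarrow>\<^sub>L 'h) \<Rightarrow> complex set" where
  "op_spectrum A =
     {c. \<not> (\<exists>B\<in>bounded_ops. B o\<^sub>L (A - scalar_op c) = id_blinfun \<and>
                             (A - scalar_op c) o\<^sub>L B = id_blinfun)}"

definition op_poly :: "real poly \<Rightarrow> ('h::chilbert_space \<Rightarrow>\<^sub>L 'h) \<Rightarrow> ('h \<Rightarrow>\<^sub>L 'h)" where
  "op_poly q A = (\<Sum>i\<le>degree q. coeff q i *\<^sub>R ((\<lambda>B. A o\<^sub>L B) ^^ i) id_blinfun)"

text \<open>Continuous functional calculus \<open>f(A)\<close> for self-adjoint \<open>A\<close> (whose spectrum is a compact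
  set of reals) and \<open>f\<close> continuous on the spectrum: the common operator-norm limit of \<open>q\<^sub>n(A)\<close> over
  all sequences of polynomials \<open>q\<^sub>n\<close> converging to \<open>f\<close> uniformly on the spectrum.\<close>

definition cfc :: "(real \<Rightarrow> real) \<Rightarrow> ('h::chilbert_space \<Rightarrow>\<^sub>L 'h) \<Rightarrow> ('h \<Rightarrow>\<^sub>L 'h)" where
  "cfc f A =
     (THE B. \<forall>q. uniform_limit {t. complex_of_real t \<in> op_spectrum A} (\<lambda>n. poly (q n)) f sequentially
                \<longrightarrow> (\<lambda>n. op_poly (q n) A) \<longlonglongrightarrow> B)"

definition abs_op :: "('h::chilbert_space \<Rightarrow>\<^sub>L 'h) \<Rightarrow> ('h \<Rightarrow>\<^sub>L 'h)" where
  "abs_op A = cfc sqrt (cadjoint A o\<^sub>L A)"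

definition Lp_norm ::
  "(('h::chilbert_space \<Rightarrow>\<^sub>L 'h) \<Rightarrow> complex) \<Rightarrow> real \<Rightarrow> ('h \<Rightarrow>\<^sub>L 'h) \<Rightarrow> real" where
  "Lp_norm \<tau> p A = Re (\<tau> (cfc (\<lambda>t. t powr p) (abs_op A))) powr (1 / p)"

definition unitary_group :: "('h::chilbert_space \<Rightarrow>\<^sub>L 'h) set \<Rightarrow> ('h \<Rightarrow>\<^sub>L 'h) set" where
  "unitary_group N =
     {U \<in> N. cadjoint U o\<^sub>L U = id_blinfun \<and> U o\<^sub>L cadjoint U = id_blinfun}"

definition sa_unitaries :: "('h::chilbert_space \<Rightarrow>\<^sub>L 'h) set \<Rightarrow> ('h \<Rightarrow>\<^sub>L 'h) set" where
  "sa_unitaries N = {U \<in> unitary_group N. cadjoint U = U}"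

definition Lp_isometry ::
  "('h::chilbert_space \<Rightarrow>\<^sub>L 'h) set \<Rightarrow> (('h \<Rightarrow>\<^sub>L 'h) \<Rightarrow> complex) \<Rightarrow> real \<Rightarrow>
   (('h \<Rightarrow>\<^sub>L 'h) \<Rightarrow> ('h \<Rightarrow>\<^sub>L 'h)) \<Rightarrow> bool" where
  "Lp_isometry N \<tau> p \<psi> \<longleftrightarrow>
     \<psi> ` unitary_group N \<subseteq> unitary_group N \<and>
     (\<forall>U\<in>unitary_group N. \<forall>V\<in>unitary_group N.
        Lp_norm \<tau> p (U - V) = Lp_norm \<tau> p (\<psi> U - \<psi> V))"

end

theory Submission
  imports Defs "HOL-Computational_Algebra.Fundamental_Theorem_Algebra"
begin

text \<open>For unitary \<open>W\<close> and self-adjoint unitary \<open>S\<close> put \<open>X = S W\<close>. Then \<open>|W - e\<^sup>i\<^sup>\<theta> S|\<^sup>2 = 2 - e\<^sup>-\<^sup>i\<^sup>\<theta> X - e\<^sup>i\<^sup>\<theta> X\<^sup>*\<close>,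
  so that \<open>\<theta> \<mapsto> \<parallel>W - e\<^sup>i\<^sup>\<theta> S\<parallel>\<^sub>p\<^sup>p\<close> is the convolution of the spectral distribution of \<open>X\<close> with \<open>|1 - e\<^sup>i\<^sup>\<theta>|\<^sup>p\<close>.
  The first Fourier coefficient of the latter is negative for every \<open>p > 0\<close>, hence the distances from
  \<open>W\<close> to all \<open>e\<^sup>i\<^sup>\<theta> S\<close> determine \<open>\<tau>(S W)\<close> for all \<open>S\<close>, that is, \<open>\<tau>(E W)\<close> for all projections \<open>E\<close> of the
  algebra. As projections onto kernels of elements stay in the algebra, this determines \<open>W\<close>. An
  isometry that fixes all \<open>e\<^sup>i\<^sup>\<theta> S\<close> therefore fixes every unitary.\<close>

section \<open>Hilbert space operators and adjoints\<close>

text \<open>No spectral measure stands behind the convolution. \<open>cfc\<close> is a definite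
  description of norm limits of polynomials, so every statement about \<open>Lp_norm\<close> has to
  pass through polynomials. For a polynomial profile the Fourier identity is algebra, since a factor
  \<open>unitary_gap X \<theta>\<close> only shifts powers of \<open>X\<close>; the profile
  \<open>t powr (p / 2)\<close> is reached by uniform approximation on [0, 4], the range of |1 -
  z|^2 on the unit circle. Two estimates make this limit legitimate: the norm of
  \<open>op_poly q A\<close> is bounded by the values of |q| on the spectrum, and \<tau> is bounded
  by the operator norm on self-adjoint elements. Both are built up from the axioms of
  \<open>chilbert_space\<close> and from positivity of \<tau>, by way of adjoints, invertibility
  from lower bounds, and roots of polynomials in the spectrum. Faithfulness and the trace property
  serve to turn "\<tau>(S D) = 0 for all self-adjoint unitaries S" into D = 0.\<close>

lemma scaleC_one [simp]: "1 *\<^sub>C (x::'h::chilbert_space) = x"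
  using scaleR_scaleC[of 1 x] by simp

lemma scaleC_zero_left [simp]: "0 *\<^sub>C (x::'h::chilbert_space) = 0"
  using scaleR_scaleC[of 0 x] by simp

lemma scaleC_zero_right [simp]: "c *\<^sub>C (0::'h::chilbert_space) = 0"
  using scaleC_add_right[of c 0 "0::'h"] by simp

lemma scaleC_minus_right [simp]: "c *\<^sub>C (- x) = - (c *\<^sub>C (x::'h::chilbert_space))"
  using scaleC_add_right[of c x "- x"] by (simp add: eq_neg_iff_add_eq_0 add.commute)

lemma scaleC_diff_right: "c *\<^sub>C (x - y) = c *\<^sub>C x - c *\<^sub>C (y::'h::chilbert_space)"
  using scaleC_add_right[of c x "- y"] by simp

lemma cinner_zero_left [simp]: "cinner 0 (y::'h::chilbert_space) = 0"
  using cinner_add_left[of 0 0 y] by simp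

lemma cinner_zero_right [simp]: "cinner (y::'h::chilbert_space) 0 = 0"
  using cinner_commute[of y 0] by simp

lemma cinner_minus_left [simp]: "cinner (- x) y = - cinner x (y::'h::chilbert_space)"
  using cinner_add_left[of x "- x" y] by (simp add: eq_neg_iff_add_eq_0 add.commute)

lemma cinner_diff_left: "cinner (x - y) z = cinner x z - cinner y (z::'h::chilbert_space)"
  using cinner_add_left[of x "- y" z] by simp

lemma cinner_add_right: "cinner z (x + y) = cinner z x + cinner z (y::'h::chilbert_space)"
  by (metis cinner_add_left cinner_commute complex_cnj_add)

lemma cinner_minus_right [simp]: "cinner x (- y) = - cinner x (y::'h::chilbert_space)"
  using cinner_add_right[of x y "- y"] by (simp add: eq_neg_iff_add_eq_0 add.commute)

lemma cinner_diff_right: "cinner z (x - y) = cinner z x - cinner z (y::'h::chilbert_space)"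
  using cinner_add_right[of z x "- y"] by simp

lemma cinner_scaleC_right: "cinner x (c *\<^sub>C y) = cnj c * cinner x (y::'h::chilbert_space)"
  by (metis cinner_commute cinner_scaleC_left complex_cnj_mult)

lemma norm_sq_eq_cinner: "(norm x)\<^sup>2 = Re (cinner x (x::'h::chilbert_space))"
  by (simp add: norm_cinner)

lemma Re_cinner_commute: "Re (cinner x y) = Re (cinner y (x::'h::chilbert_space))"
  using cinner_commute[of x y] by simp

lemma norm_add_sq:
  "(norm (x + y))\<^sup>2 = (norm x)\<^sup>2 + 2 * Re (cinner x y) + (norm (y::'h::chilbert_space))\<^sup>2"
  using Re_cinner_commute[of x y]
  by (simp add: norm_sq_eq_cinner cinner_add_left cinner_add_right)

lemma norm_diff_sq:
  "(norm (x - y))\<^sup>2 = (norm x)\<^sup>2 - 2 * Re (cinner x y) + (norm (y::'h::chilbert_space))\<^sup>2"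
  using norm_add_sq[of x "- y"] by simp

text \<open>Pythagoras for the component of \<open>x\<close> along \<open>y\<close>. Since the left
  side is nonnegative this is Cauchy-Schwarz; at a point of minimal distance it forces the inner
  product to vanish.\<close>

lemma norm_diff_projection_sq:
  fixes x y :: "'h::chilbert_space"
  assumes "y \<noteq> 0"
  shows "(norm (x - (cinner x y / (norm y)\<^sup>2) *\<^sub>C y))\<^sup>2
    = (norm x)\<^sup>2 - (cmod (cinner x y))\<^sup>2 / (norm y)\<^sup>2"
proof -
  define a where "a = cinner x y"
  have "a * cnj a = of_real ((cmod a)\<^sup>2)"
    by (metis complex_norm_square of_real_power)
  then have "cinner x ((a / (norm y)\<^sup>2) *\<^sub>C y) = of_real ((cmod a)\<^sup>2 / (norm y)\<^sup>2)"
    by (simp add: cinner_scaleC_right a_def[symmetric] mult.commute)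
  moreover have "(norm ((a / (norm y)\<^sup>2) *\<^sub>C y))\<^sup>2 = (cmod a)\<^sup>2 / (norm y)\<^sup>2"
    using assms by (simp add: norm_scaleC norm_divide norm_mult power2_eq_square)
  ultimately show ?thesis
    by (simp add: norm_diff_sq a_def)
qed

lemma cinner_Cauchy_Schwarz: "cmod (cinner x y) \<le> norm x * norm (y::'h::chilbert_space)"
proof (cases "y = 0")
  case False
  have "0 \<le> (norm x)\<^sup>2 - (cmod (cinner x y))\<^sup>2 / (norm y)\<^sup>2"
    using norm_diff_projection_sq[OF False, of x] by (metis zero_le_power2)
  then have "(cmod (cinner x y))\<^sup>2 \<le> (norm x * norm y)\<^sup>2"
    using False by (simp add: field_simps power_mult_distrib)
  then show ?thesis
    by (meson mult_nonneg_nonneg norm_ge_zero power2_le_imp_le)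
qed simp

lemma cinner_eq_all_left:
  fixes y z :: "'h::chilbert_space"
  assumes "\<And>x. cinner x y = cinner x z"
  shows "y = z"
proof -
  have "cinner (y - z) (y - z) = 0"
    using assms by (simp add: cinner_diff_right)
  then show ?thesis
    by (simp add: norm_cinner)
qed

lemma closed_subspace_projection:
  fixes K :: "'h::chilbert_space set"
  assumes "closed K" and "0 \<in> K"
    and K_add: "\<And>x y. x \<in> K \<Longrightarrow> y \<in> K \<Longrightarrow> x + y \<in> K"
    and K_scale: "\<And>c x. x \<in> K \<Longrightarrow> c *\<^sub>C x \<in> K"
  shows "\<exists>y\<in>K. \<forall>k\<in>K. cinner (x - y) k = 0"
proof -
  define d where "d = (INF k\<in>K. norm (x - k))"
  have bdd: "bdd_below ((\<lambda>k. norm (x - k)) ` K)"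
    by (rule bdd_belowI2[of _ 0]) simp
  have d_le: "d \<le> norm (x - k)" if "k \<in> K" for k
    unfolding d_def using bdd that by (rule cINF_lower)
  have "d \<ge> 0"
    unfolding d_def using \<open>0 \<in> K\<close> by (intro cINF_greatest) auto
  have "\<exists>k\<in>K. (norm (x - k))\<^sup>2 < d\<^sup>2 + e" if "e > 0" for e
  proof -
    have "d < sqrt (d\<^sup>2 + e)"
      using that \<open>d \<ge> 0\<close> by (intro real_less_rsqrt) simp
    then obtain k where k: "k \<in> K" "norm (x - k) < sqrt (d\<^sup>2 + e)"
      unfolding d_def using bdd \<open>0 \<in> K\<close> cINF_less_iff[of K "\<lambda>k. norm (x - k)"] by blast
    have "(norm (x - k))\<^sup>2 < (sqrt (d\<^sup>2 + e))\<^sup>2"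
      using k by (intro power_strict_mono) auto
    then show ?thesis
      using k that by auto
  qed
  then have "\<exists>k\<in>K. (norm (x - k))\<^sup>2 < d\<^sup>2 + inverse (real (Suc n))" for n
    by simp
  then obtain s where sK: "\<And>n. s n \<in> K"
    and s: "\<And>n. (norm (x - s n))\<^sup>2 < d\<^sup>2 + inverse (real (Suc n))"
    by metis
  \<comment> \<open>The midpoint of two members of the minimising sequence lies in \<open>K\<close>,
    hence has distance at least \<open>d\<close> from \<open>x\<close>; the parallelogram law
    converts this into closeness of the two members.\<close>
  have close: "(norm (s m - s n))\<^sup>2 \<le> 2 * inverse (real (Suc m)) + 2 * inverse (real (Suc n))" for m n
  proof -
    define z where "z = (1/2) *\<^sub>C (s m + s n)"
    have "z \<in> K"
      unfolding z_def by (intro K_scale K_add sK)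
    then have "d\<^sup>2 \<le> (norm (x - z))\<^sup>2"
      using d_le \<open>d \<ge> 0\<close> by (simp add: power_mono)
    moreover have "2 *\<^sub>R (x - z) = (x - s m) + (x - s n)"
    proof -
      have "z = (1/2) *\<^sub>R (s m + s n)"
        by (simp add: z_def scaleR_scaleC)
      then show ?thesis
        by (simp add: scaleR_diff_right) (simp add: scaleR_2)
    qed
    then have "4 * (norm (x - z))\<^sup>2 = (norm ((x - s m) + (x - s n)))\<^sup>2"
      by (metis (no_types, lifting) norm_scaleR abs_numeral power_mult_distrib power2_eq_square
          numeral_Bit0 mult_2 mult.assoc one_add_one)
    ultimately have "4 * d\<^sup>2 \<le> (norm ((x - s m) + (x - s n)))\<^sup>2"
      by simp
    moreover have "(norm ((x - s m) + (x - s n)))\<^sup>2 + (norm (s m - s n))\<^sup>2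
        = 2 * (norm (x - s m))\<^sup>2 + 2 * (norm (x - s n))\<^sup>2"
      using norm_diff_sq[of "x - s n" "x - s m"] norm_add_sq[of "x - s n" "x - s m"]
      by (simp add: algebra_simps)
    ultimately show ?thesis
      using s[of m] s[of n] by linarith
  qed
  have "Cauchy s"
  proof (rule metric_CauchyI)
    fix e :: real
    assume "e > 0"
    then obtain M where M: "inverse (real (Suc M)) < e\<^sup>2 / 4"
      using reals_Archimedean[of "e\<^sup>2 / 4"] by auto
    have "dist (s m) (s n) < e" if "m \<ge> M" "n \<ge> M" for m n
    proof -
      have "inverse (real (Suc m)) \<le> inverse (real (Suc M))"
        "inverse (real (Suc n)) \<le> inverse (real (Suc M))"
        using that by (auto intro: le_imp_inverse_le)
      then have "(norm (s m - s n))\<^sup>2 < e\<^sup>2"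
        using close[of m n] M by linarith
      then show ?thesis
        using \<open>e > 0\<close> by (simp add: dist_norm power2_less_imp_less)
    qed
    then show "\<exists>M. \<forall>m\<ge>M. \<forall>n\<ge>M. dist (s m) (s n) < e"
      by blast
  qed
  then obtain y where y: "s \<longlonglongrightarrow> y"
    using Cauchy_convergent convergent_def by blast
  have "y \<in> K"
    using \<open>closed K\<close> sK y closed_sequentially by blast
  have "(\<lambda>n. d\<^sup>2 + inverse (real (Suc n))) \<longlonglongrightarrow> d\<^sup>2 + 0"
    by (intro tendsto_intros LIMSEQ_inverse_real_of_nat)
  moreover have "(\<lambda>n. (norm (x - s n))\<^sup>2) \<longlonglongrightarrow> (norm (x - y))\<^sup>2"
    by (intro tendsto_intros y)
  ultimately have y_le: "(norm (x - y))\<^sup>2 \<le> d\<^sup>2"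
    using s by (intro LIMSEQ_le[of _ _ "\<lambda>n. d\<^sup>2 + inverse (real (Suc n))"]) (auto intro: less_imp_le)
  have "cinner (x - y) k = 0" if "k \<in> K" for k
  proof (cases "k = 0")
    case False
    \<comment> \<open>The optimal coefficient: moving \<open>y\<close> by
      \<open>c *\<^sub>C k\<close> lowers the squared distance by |<x - y, k>|^2 / |k|^2, which
      minimality forbids unless it is zero.\<close>
    define c where "c = cinner (x - y) k / (norm k)\<^sup>2"
    have "y + c *\<^sub>C k \<in> K"
      using \<open>y \<in> K\<close> that K_add K_scale by blast
    then have "d\<^sup>2 \<le> (norm (x - y - c *\<^sub>C k))\<^sup>2"
      using d_le[of "y + c *\<^sub>C k"] \<open>d \<ge> 0\<close> by (simp add: power_mono diff_diff_eq)
    also have "\<dots> = (norm (x - y))\<^sup>2 - (cmod (cinner (x - y) k))\<^sup>2 / (norm k)\<^sup>2"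
      unfolding c_def by (rule norm_diff_projection_sq[OF False])
    finally have "(cmod (cinner (x - y) k))\<^sup>2 / (norm k)\<^sup>2 \<le> 0"
      using y_le by linarith
    then show ?thesis
      using False by (simp add: divide_le_0_iff)
  qed simp
  then show ?thesis
    using \<open>y \<in> K\<close> by blast
qed

text \<open>If \<open>f\<close> is not zero, take \<open>z\<close> orthogonal to its kernel.
  Subtracting \<open>(f x / f z) *\<^sub>C z\<close> from \<open>x\<close> lands in the kernel, so
  the inner product with \<open>z\<close> recovers \<open>f x\<close> up to a factor.\<close>

lemma Riesz_representation:
  fixes f :: "'h::chilbert_space \<Rightarrow> complex"
  assumes add: "\<And>x y. f (x + y) = f x + f y"
    and scale: "\<And>c x. f (c *\<^sub>C x) = c * f x"
    and bound: "\<And>x. cmod (f x) \<le> norm x * M"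
  shows "\<exists>z. \<forall>x. f x = cinner x z"
proof (cases "\<forall>x. f x = 0")
  case True
  then show ?thesis
    by (intro exI[of _ 0]) simp
next
  case False
  then obtain u where u: "f u \<noteq> 0"
    by blast
  interpret f: bounded_linear f
    by (rule bounded_linear_intro[OF add _ bound])
       (simp add: scaleR_scaleC scale scaleR_conv_of_real)
  have "closed {x. f x = 0}"
    by (intro closed_Collect_eq f.continuous_on continuous_intros)
  then obtain y where y: "f y = 0" and ort: "\<And>k. f k = 0 \<Longrightarrow> cinner (u - y) k = 0"
    using closed_subspace_projection[of "{x. f x = 0}" u] by (auto simp: add scale f.zero)
  define z where "z = u - y"
  have fz: "f z \<noteq> 0"
    using u y by (simp add: z_def f.diff)
  then have "z \<noteq> 0"
    using f.zero by auto
  have "f x = cinner x ((cnj (f z) / (norm z)\<^sup>2) *\<^sub>C z)" for x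
  proof -
    have "f (x - (f x / f z) *\<^sub>C z) = 0"
      using fz by (simp add: f.diff scale)
    then have "cinner (x - (f x / f z) *\<^sub>C z) z = 0"
      using ort cinner_commute[of _ z] by (simp add: z_def)
    then have "cinner x z = f x / f z * (norm z)\<^sup>2"
      by (simp add: cinner_diff_left cinner_scaleC_left norm_cinner)
    then show ?thesis
      using fz \<open>z \<noteq> 0\<close> by (simp add: cinner_scaleC_right)
  qed
  then show ?thesis
    by blast
qed

section \<open>Adjoints and the algebra of complex linear operators\<close>

lemma bounded_ops_scaleC: "A \<in> bounded_ops \<Longrightarrow> blinfun_apply A (c *\<^sub>C x) = c *\<^sub>C blinfun_apply A x"
  by (simp add: bounded_ops_def)

lemma cadjoint_unique:
  assumes "\<And>x y. cinner (blinfun_apply A x) y = cinner x (blinfun_apply B y)"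
  shows "cadjoint A = B"
  unfolding cadjoint_def
proof (rule the_equality)
  show "\<forall>x y. cinner (blinfun_apply A x) y = cinner x (blinfun_apply B y)"
    using assms by blast
next
  fix C assume C: "\<forall>x y. cinner (blinfun_apply A x) y = cinner x (blinfun_apply C y)"
  show "C = B"
    by (rule blinfun_eqI, rule cinner_eq_all_left) (metis C assms)
qed

text \<open>The description in \<open>cadjoint\<close> denotes only once a witness exists. Riesz
  gives one vector for each \<open>y\<close>; boundedness of the resulting map follows by testing
  the identity at x = b y and cancelling one factor \<open>norm (b y)\<close>.\<close>

lemma cadjoint_exists:
  assumes A: "A \<in> bounded_ops"
  shows "\<exists>B. \<forall>x y. cinner (blinfun_apply A x) y = cinner x (blinfun_apply B y)"
proof -
  have "\<exists>z. \<forall>x. cinner (blinfun_apply A x) y = cinner x z" for y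
  proof (rule Riesz_representation)
    show "cmod (cinner (blinfun_apply A x) y) \<le> norm x * (norm A * norm y)" for x
      using cinner_Cauchy_Schwarz[of "blinfun_apply A x" y]
        mult_right_mono[OF norm_blinfun[of A x], of "norm y"]
      by (simp add: mult_ac)
  qed (use A in \<open>simp_all add: blinfun.add_right cinner_add_left bounded_ops_scaleC cinner_scaleC_left\<close>)
  then obtain b where b: "\<And>x y. cinner (blinfun_apply A x) y = cinner x (b y)"
    by metis
  have "bounded_linear b"
  proof (rule bounded_linear_intro)
    show "b (y + z) = b y + b z" for y z
      by (rule cinner_eq_all_left) (simp add: cinner_add_right flip: b)
    show "b (r *\<^sub>R y) = r *\<^sub>R b y" for r y
      by (rule cinner_eq_all_left) (simp add: scaleR_scaleC cinner_scaleC_right flip: b)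
    show "norm (b y) \<le> norm y * norm A" for y
    proof (cases "b y = 0")
      case False
      have "norm (b y) * norm (b y) = Re (cinner (blinfun_apply A (b y)) y)"
        by (simp add: b norm_cinner power2_eq_square)
      also have "\<dots> \<le> cmod (cinner (blinfun_apply A (b y)) y)"
        by (rule complex_Re_le_cmod)
      also have "\<dots> \<le> norm (blinfun_apply A (b y)) * norm y"
        by (rule cinner_Cauchy_Schwarz)
      also have "\<dots> \<le> norm A * norm (b y) * norm y"
        by (intro mult_right_mono norm_blinfun) simp
      also have "\<dots> = (norm y * norm A) * norm (b y)"
        by simp
      finally show ?thesis
        using False by simp
    qed simp
  qed
  then show ?thesis
    by (intro exI[of _ "Blinfun b"]) (simp add: bounded_linear_Blinfun_apply b)
qed

lemma cinner_cadjoint: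
  assumes "A \<in> bounded_ops"
  shows "cinner (blinfun_apply A x) y = cinner x (blinfun_apply (cadjoint A) y)"
  using cadjoint_exists[OF assms] cadjoint_unique by metis

lemma cinner_cadjoint':
  assumes "A \<in> bounded_ops"
  shows "cinner (blinfun_apply (cadjoint A) x) y = cinner x (blinfun_apply A y)"
  by (metis assms cinner_cadjoint cinner_commute)

lemma cadjoint_bounded_ops [intro, simp]:
  assumes "A \<in> bounded_ops"
  shows "cadjoint A \<in> bounded_ops"
proof -
  have "blinfun_apply (cadjoint A) (c *\<^sub>C y) = c *\<^sub>C blinfun_apply (cadjoint A) y" for c y
    by (rule cinner_eq_all_left)
       (simp add: cinner_scaleC_right flip: cinner_cadjoint[OF assms])
  then show ?thesis
    by (simp add: bounded_ops_def)
qed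

lemma cadjoint_cadjoint [simp]: "A \<in> bounded_ops \<Longrightarrow> cadjoint (cadjoint A) = A"
  by (rule cadjoint_unique) (rule cinner_cadjoint')

lemma scalar_op_apply [simp]: "blinfun_apply (scalar_op c) x = c *\<^sub>C x"
  by (simp add: scalar_op.rep_eq)

lemma bounded_ops_compose [intro, simp]:
  "A \<in> bounded_ops \<Longrightarrow> B \<in> bounded_ops \<Longrightarrow> A o\<^sub>L B \<in> bounded_ops"
  by (simp add: bounded_ops_def)

lemma bounded_ops_add [intro, simp]:
  "A \<in> bounded_ops \<Longrightarrow> B \<in> bounded_ops \<Longrightarrow> A + B \<in> bounded_ops"
  by (simp add: bounded_ops_def blinfun.add_left scaleC_add_right)

lemma bounded_ops_diff [intro, simp]:
  "A \<in> bounded_ops \<Longrightarrow> B \<in> bounded_ops \<Longrightarrow> A - B \<in> bounded_ops"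
  by (simp add: bounded_ops_def blinfun.diff_left scaleC_diff_right)

lemma bounded_ops_scalar_op [intro, simp]: "scalar_op c \<in> bounded_ops"
  by (simp add: bounded_ops_def scaleC_scaleC mult.commute)

lemma bounded_ops_id [intro, simp]: "id_blinfun \<in> bounded_ops"
  by (simp add: bounded_ops_def)

lemma bounded_ops_0 [intro, simp]: "0 \<in> bounded_ops"
  by (simp add: bounded_ops_def)

lemma bounded_ops_scaleR [intro, simp]: "A \<in> bounded_ops \<Longrightarrow> r *\<^sub>R A \<in> bounded_ops"
  by (simp add: bounded_ops_def blinfun.scaleR_left scaleR_scaleC scaleC_scaleC mult.commute)

lemma cadjoint_compose:
  "A \<in> bounded_ops \<Longrightarrow> B \<in> bounded_ops \<Longrightarrow> cadjoint (A o\<^sub>L B) = cadjoint B o\<^sub>L cadjoint A"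
  by (rule cadjoint_unique) (simp add: cinner_cadjoint)

lemma cadjoint_add:
  "A \<in> bounded_ops \<Longrightarrow> B \<in> bounded_ops \<Longrightarrow> cadjoint (A + B) = cadjoint A + cadjoint B"
  by (rule cadjoint_unique) (simp add: cinner_cadjoint blinfun.add_left cinner_add_left cinner_add_right)

lemma cadjoint_diff:
  "A \<in> bounded_ops \<Longrightarrow> B \<in> bounded_ops \<Longrightarrow> cadjoint (A - B) = cadjoint A - cadjoint B"
  by (rule cadjoint_unique) (simp add: cinner_cadjoint blinfun.diff_left cinner_diff_left cinner_diff_right)

lemma cadjoint_scalar_op [simp]: "cadjoint (scalar_op c) = scalar_op (cnj c)"
  by (rule cadjoint_unique) (simp add: cinner_scaleC_left cinner_scaleC_right)

lemma cadjoint_id [simp]: "cadjoint id_blinfun = id_blinfun"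
  by (rule cadjoint_unique) simp

lemma cadjoint_scaleR: "A \<in> bounded_ops \<Longrightarrow> cadjoint (r *\<^sub>R A) = r *\<^sub>R cadjoint A"
  by (rule cadjoint_unique)
     (simp add: cinner_cadjoint blinfun.scaleR_left scaleR_scaleC cinner_scaleC_left cinner_scaleC_right)

lemma cadjoint_0 [simp]: "cadjoint 0 = 0"
  by (rule cadjoint_unique) simp

section \<open>Invertibility and spectrum\<close>

interpretation ocomp: bounded_bilinear "(o\<^sub>L) :: ('h::real_normed_vector \<Rightarrow>\<^sub>L 'h) \<Rightarrow> _"
  by (rule bounded_bilinear_blinfun_compose)

lemma ocomp_assoc: "(A o\<^sub>L B) o\<^sub>L C = A o\<^sub>L (B o\<^sub>L C)"
  by (rule blinfun_eqI) simp

lemma ocomp_id [simp]: "A o\<^sub>L id_blinfun = A" "id_blinfun o\<^sub>L A = A"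
  by (rule blinfun_eqI; simp)+

lemma scalar_op_of_real: "scalar_op (complex_of_real r) = r *\<^sub>R id_blinfun"
  by (rule blinfun_eqI) (simp add: blinfun.scaleR_left scaleR_scaleC)

lemma scalar_op_simps:
  "scalar_op (a + b) = scalar_op a + scalar_op b"
  "scalar_op a o\<^sub>L scalar_op b = scalar_op (a * b)"
  "scalar_op 0 = 0" "scalar_op 1 = id_blinfun"
  by (rule blinfun_eqI; simp add: blinfun.add_left scaleC_add_left scaleC_scaleC)+

lemma scalar_op_minus: "scalar_op (- a) = - scalar_op a"
  using scalar_op_simps(1)[of a "- a"] by (simp add: scalar_op_simps eq_neg_iff_add_eq_0 add.commute)

lemma scalar_op_commute: "A \<in> bounded_ops \<Longrightarrow> A o\<^sub>L scalar_op c = scalar_op c o\<^sub>L A"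
  by (rule blinfun_eqI) (simp add: bounded_ops_scaleC)

lemma ocomp_scalar_op_left:
  "A \<in> bounded_ops \<Longrightarrow> A o\<^sub>L (scalar_op c o\<^sub>L B) = scalar_op c o\<^sub>L (A o\<^sub>L B)"
  by (metis ocomp_assoc scalar_op_commute)

definition invertible_op :: "('h::chilbert_space \<Rightarrow>\<^sub>L 'h) \<Rightarrow> bool" where
  "invertible_op T \<longleftrightarrow> (\<exists>B\<in>bounded_ops. B o\<^sub>L T = id_blinfun \<and> T o\<^sub>L B = id_blinfun)"

lemma op_spectrum_iff: "z \<in> op_spectrum A \<longleftrightarrow> \<not> invertible_op (A - scalar_op z)"
  by (simp add: op_spectrum_def invertible_op_def)

text \<open>Left and right inverse coincide by associativity, and the inverse of a complex linear
  map is complex linear. Inverses may thus be constructed among real bounded operators, as in the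
  Neumann series.\<close>

lemma invertible_opI:
  assumes T: "T \<in> bounded_ops" and L: "L o\<^sub>L T = id_blinfun" and R: "T o\<^sub>L R = id_blinfun"
  shows "invertible_op T"
proof -
  have "L = R"
    by (metis L R ocomp_assoc ocomp_id)
  have LT: "blinfun_apply L (blinfun_apply T x) = x" for x
    by (metis L blinfun_apply_blinfun_compose blinfun_apply_id_blinfun)
  have TR: "blinfun_apply T (blinfun_apply L x) = x" for x
    by (metis R \<open>L = R\<close> blinfun_apply_blinfun_compose blinfun_apply_id_blinfun)
  have "blinfun_apply L (c *\<^sub>C x) = c *\<^sub>C blinfun_apply L x" for c x
    by (metis LT TR T bounded_ops_scaleC)
  then have "L \<in> bounded_ops"
    by (simp add: bounded_ops_def)
  then show ?thesis
    using L R \<open>L = R\<close> by (auto simp: invertible_op_def)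
qed

lemma invertible_op_compose:
  assumes "invertible_op S" "invertible_op T"
  shows "invertible_op (S o\<^sub>L T)"
proof -
  obtain B C where B: "B \<in> bounded_ops" "B o\<^sub>L S = id_blinfun" "S o\<^sub>L B = id_blinfun"
    and C: "C \<in> bounded_ops" "C o\<^sub>L T = id_blinfun" "T o\<^sub>L C = id_blinfun"
    using assms by (auto simp: invertible_op_def)
  have "(C o\<^sub>L B) o\<^sub>L (S o\<^sub>L T) = id_blinfun" "(S o\<^sub>L T) o\<^sub>L (C o\<^sub>L B) = id_blinfun"
    by (metis B C ocomp_assoc ocomp_id)+
  then show ?thesis
    using B C by (auto simp: invertible_op_def)
qed

lemma Neumann_series:
  fixes Q :: "'h::banach \<Rightarrow>\<^sub>L 'h"
  assumes "norm Q < 1"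
  shows "\<exists>B. B o\<^sub>L (id_blinfun - Q) = id_blinfun \<and> (id_blinfun - Q) o\<^sub>L B = id_blinfun"
proof -
  define P where "P n = ((\<lambda>B. Q o\<^sub>L B) ^^ n) id_blinfun" for n
  have P_Suc: "P (Suc n) = Q o\<^sub>L P n" and P_0: "P 0 = id_blinfun" for n
    by (simp_all add: P_def)
  have "norm (P n) \<le> norm Q ^ n" for n
  proof (induction n)
    case (Suc n)
    have "norm (P (Suc n)) \<le> norm Q * norm (P n)"
      by (simp add: P_Suc norm_blinfun_compose)
    also have "\<dots> \<le> norm Q * norm Q ^ n"
      using Suc by (simp add: mult_left_mono)
    finally show ?case
      by simp
  qed (simp add: P_0 norm_blinfun_id_le)
  then have sm: "summable P"
    using assms by (intro summable_comparison_test'[OF summable_geometric[of "norm Q"]]) auto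
  have comm: "P n o\<^sub>L Q = P (Suc n)" for n
    by (induction n) (simp_all add: P_Suc P_0 ocomp_assoc)
  define B where "B = suminf P"
  have B: "B = id_blinfun + (\<Sum>n. P (Suc n))"
    using suminf_split_initial_segment[OF sm, of 1] by (simp add: B_def P_0)
  have "Q o\<^sub>L B = (\<Sum>n. P (Suc n))"
    unfolding B_def P_Suc by (rule bounded_linear.suminf[OF ocomp.bounded_linear_right sm])
  moreover have "B o\<^sub>L Q = (\<Sum>n. P (Suc n))"
    unfolding B_def comm[symmetric] by (rule bounded_linear.suminf[OF ocomp.bounded_linear_left sm])
  ultimately show ?thesis
    using B by (intro exI[of _ B]) (simp add: ocomp.diff_left ocomp.diff_right)
qed

text \<open>With P the Gram operator, |x - e P x|^2 = |x|^2 - 2 e |S x|^2 + e^2 |P x|^2 is at most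
  (1 - 2 e c^2 + e^2 M^2) |x|^2. For suitable \<open>e\<close> this makes
  \<open>id_blinfun - e *\<^sub>R P\<close> a strict contraction, and the Neumann series inverts e
  P.\<close>

lemma gram_invertible:
  fixes S :: "'h::chilbert_space \<Rightarrow>\<^sub>L 'h"
  assumes S: "S \<in> bounded_ops" and "c > 0"
    and below: "\<And>x. c * norm x \<le> norm (blinfun_apply S x)"
  shows "\<exists>B. B o\<^sub>L (cadjoint S o\<^sub>L S) = id_blinfun \<and> (cadjoint S o\<^sub>L S) o\<^sub>L B = id_blinfun"
proof -
  define P where "P = cadjoint S o\<^sub>L S"
  \<comment> \<open>\<open>M\<close> dominates \<open>norm P\<close> and exceeds c^2. The choice of
    \<open>e\<close> minimises 1 - 2 e c^2 + e^2 M^2; \<open>k\<close> is the minimum, and c^2 < M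
    keeps it in [0, 1).\<close>
  define M where "M = norm P + c\<^sup>2 + 1"
  define e where "e = c\<^sup>2 / M\<^sup>2"
  define k where "k = 1 - (c\<^sup>2 / M)\<^sup>2"
  have M: "M > 0" "norm P \<le> M" "c\<^sup>2 < M"
    using \<open>c > 0\<close> by (auto simp: M_def add_nonneg_pos)
  have e: "e > 0"
    using M \<open>c > 0\<close> by (simp add: e_def)
  have "c\<^sup>2 / M < 1" "0 < c\<^sup>2 / M"
    using M \<open>c > 0\<close> by simp_all
  then have k: "0 \<le> k" "k < 1"
    by (auto simp: k_def power_le_one)
  have "norm (blinfun_apply (id_blinfun - e *\<^sub>R P) x) \<le> sqrt k * norm x" for x
  proof -
    have Sx: "cinner x (blinfun_apply P x) = of_real ((norm (blinfun_apply S x))\<^sup>2)"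
      by (simp add: P_def norm_cinner flip: cinner_cadjoint[OF S])
    have 1: "c\<^sup>2 * (norm x)\<^sup>2 \<le> (norm (blinfun_apply S x))\<^sup>2"
      using power_mono[OF below[of x], of 2] \<open>c > 0\<close> by (simp add: power_mult_distrib)
    have "norm (blinfun_apply P x) \<le> M * norm x"
      by (rule order_trans[OF norm_blinfun]) (simp add: M mult_right_mono)
    then have 2: "(norm (blinfun_apply P x))\<^sup>2 \<le> M\<^sup>2 * (norm x)\<^sup>2"
      using power_mono[of "norm (blinfun_apply P x)" "M * norm x" 2] by (simp add: power_mult_distrib)
    have "(norm (blinfun_apply (id_blinfun - e *\<^sub>R P) x))\<^sup>2
        = (norm x)\<^sup>2 - 2 * (e * (norm (blinfun_apply S x))\<^sup>2) + e\<^sup>2 * (norm (blinfun_apply P x))\<^sup>2"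
      by (simp add: blinfun.diff_left blinfun.scaleR_left norm_diff_sq scaleR_scaleC
          cinner_scaleC_right Sx norm_scaleC power_mult_distrib)
    also have "\<dots> \<le> (norm x)\<^sup>2 - 2 * (e * (c\<^sup>2 * (norm x)\<^sup>2)) + e\<^sup>2 * (M\<^sup>2 * (norm x)\<^sup>2)"
      using mult_left_mono[OF 1 less_imp_le[OF e]] mult_left_mono[OF 2 zero_le_power2[of e]]
      by linarith
    also have "\<dots> = (1 - 2 * e * c\<^sup>2 + e\<^sup>2 * M\<^sup>2) * (norm x)\<^sup>2"
      by (simp add: algebra_simps)
    also have "1 - 2 * e * c\<^sup>2 + e\<^sup>2 * M\<^sup>2 = k"
      using M by (simp add: e_def k_def field_simps power2_eq_square)
    also have "k * (norm x)\<^sup>2 = (sqrt k * norm x)\<^sup>2"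
      using k by (simp add: power_mult_distrib)
    finally show ?thesis
      by (rule power2_le_imp_le) (use k in simp)
  qed
  then have "norm (id_blinfun - e *\<^sub>R P) \<le> sqrt k"
    using k by (intro norm_blinfun_bound) auto
  also have "\<dots> < 1"
    using k by simp
  finally obtain B where "B o\<^sub>L (e *\<^sub>R P) = id_blinfun" "(e *\<^sub>R P) o\<^sub>L B = id_blinfun"
    using Neumann_series[of "id_blinfun - e *\<^sub>R P"] by auto
  then show ?thesis
    by (intro exI[of _ "e *\<^sub>R B"])
       (simp add: P_def[symmetric] ocomp.scaleR_left ocomp.scaleR_right)
qed

text \<open>Inverting the Gram operator of \<open>T\<close> yields a left inverse of
  \<open>T\<close>, inverting that of \<open>cadjoint T\<close> a right inverse; this is why both
  lower bounds are required.\<close>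

lemma bounded_below_invertible:
  fixes T :: "'h::chilbert_space \<Rightarrow>\<^sub>L 'h"
  assumes T: "T \<in> bounded_ops" and "c > 0"
    and 1: "\<And>x. c * norm x \<le> norm (blinfun_apply T x)"
    and 2: "\<And>x. c * norm x \<le> norm (blinfun_apply (cadjoint T) x)"
  shows "invertible_op T"
proof -
  obtain B where B: "B o\<^sub>L (cadjoint T o\<^sub>L T) = id_blinfun"
    using gram_invertible[OF T \<open>c > 0\<close> 1] by blast
  obtain C where C: "(T o\<^sub>L cadjoint T) o\<^sub>L C = id_blinfun"
    using gram_invertible[OF cadjoint_bounded_ops[OF T] \<open>c > 0\<close> 2] T by auto
  show ?thesis
    by (rule invertible_opI[OF T, of "B o\<^sub>L cadjoint T" "cadjoint T o\<^sub>L C"])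
       (use B C in \<open>simp_all add: ocomp_assoc\<close>)
qed

section \<open>Location of the spectrum of a self-adjoint operator\<close>

definition self_adjoint_op :: "('h::chilbert_space \<Rightarrow>\<^sub>L 'h) \<Rightarrow> bool" where
  "self_adjoint_op A \<longleftrightarrow> A \<in> bounded_ops \<and> cadjoint A = A"

definition real_spectrum :: "('h::chilbert_space \<Rightarrow>\<^sub>L 'h) \<Rightarrow> real set" where
  "real_spectrum A = {t. complex_of_real t \<in> op_spectrum A}"

lemma self_adjoint_op_cinner:
  "self_adjoint_op A \<Longrightarrow> cinner (blinfun_apply A x) y = cinner x (blinfun_apply A y)"
  using cinner_cadjoint[of A x y] by (simp add: self_adjoint_op_def)

lemma self_adjoint_op_Im_cinner:
  assumes "self_adjoint_op A"
  shows "Im (cinner (blinfun_apply A x) x) = 0"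
proof -
  have "cinner (blinfun_apply A x) x = cnj (cinner (blinfun_apply A x) x)"
    using self_adjoint_op_cinner[OF assms] cinner_commute by metis
  then show ?thesis
    by (simp add: complex_eq_iff)
qed

lemma op_spectrum_self_adjoint_real:
  assumes A: "self_adjoint_op A" and z: "z \<in> op_spectrum A"
  shows "Im z = 0"
proof (rule ccontr)
  assume Im: "Im z \<noteq> 0"
  \<comment> \<open>The cross term between (A - Re w) x and i (Im w) x has real part zero, so the
    squared norms add. Stated for every \<open>w\<close> because the adjoint of A - z is A - cnj
    z.\<close>
  have below: "\<bar>Im w\<bar> * norm x \<le> norm (blinfun_apply (A - scalar_op w) x)" for w x
  proof -
    define y where "y = blinfun_apply A x - complex_of_real (Re w) *\<^sub>C x"
    have "w *\<^sub>C x = complex_of_real (Re w) *\<^sub>C x + (\<i> * complex_of_real (Im w)) *\<^sub>C x"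
      unfolding scaleC_add_left[symmetric] by (simp flip: complex_eq)
    then have eq: "blinfun_apply (A - scalar_op w) x = y - (\<i> * complex_of_real (Im w)) *\<^sub>C x"
      by (simp only: y_def blinfun.diff_left scalar_op_apply diff_diff_eq)
    have "Im (cinner y x) = 0"
      using self_adjoint_op_Im_cinner[OF A, of x]
      by (simp add: y_def cinner_diff_left cinner_scaleC_left norm_cinner)
    then have "Re (cinner y ((\<i> * complex_of_real (Im w)) *\<^sub>C x)) = 0"
      by (simp add: cinner_scaleC_right)
    then have "(norm (blinfun_apply (A - scalar_op w) x))\<^sup>2 = (norm y)\<^sup>2 + (\<bar>Im w\<bar> * norm x)\<^sup>2"
      unfolding eq norm_diff_sq by (simp add: norm_scaleC norm_mult)
    then show ?thesis
      by - (rule power2_le_imp_le, simp_all)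
  qed
  have "cadjoint (A - scalar_op z) = A - scalar_op (cnj z)"
    using A by (simp add: self_adjoint_op_def cadjoint_diff)
  then have "invertible_op (A - scalar_op z)"
    using A Im below[of z] below[of "cnj z"]
    by (intro bounded_below_invertible[of _ "\<bar>Im z\<bar>"]) (auto simp: self_adjoint_op_def)
  then show False
    using z by (simp add: op_spectrum_iff)
qed

text \<open>For real \<open>t\<close> the operator A - t is its own adjoint, so one lower bound
  meets both hypotheses of \<open>bounded_below_invertible\<close>.\<close>

lemma real_spectrum_bounded_below:
  assumes A: "self_adjoint_op A" and t: "t \<in> real_spectrum A" and "c > 0"
    and "\<And>x. c * norm x \<le> norm (blinfun_apply A x - t *\<^sub>R x)"
  shows False
proof -
  have "cadjoint (A - scalar_op (of_real t)) = A - scalar_op (of_real t)"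
    using A by (simp add: self_adjoint_op_def cadjoint_diff)
  then have "invertible_op (A - scalar_op (of_real t))"
    using assms by (intro bounded_below_invertible[of _ c])
      (auto simp: self_adjoint_op_def blinfun.diff_left scaleR_scaleC)
  then show False
    using t by (simp add: op_spectrum_iff real_spectrum_def)
qed

lemma real_spectrum_le_norm:
  assumes A: "self_adjoint_op A" and t: "t \<in> real_spectrum A"
  shows "\<bar>t\<bar> \<le> norm A"
proof (rule ccontr)
  assume "\<not> \<bar>t\<bar> \<le> norm A"
  moreover have "(\<bar>t\<bar> - norm A) * norm x \<le> norm (blinfun_apply A x - t *\<^sub>R x)" for x
    using norm_triangle_ineq2[of "t *\<^sub>R x" "blinfun_apply A x"] norm_blinfun[of A x]
    by (simp add: norm_minus_commute left_diff_distrib)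
  ultimately show False
    using real_spectrum_bounded_below[OF A t, of "\<bar>t\<bar> - norm A"] by simp
qed

text \<open>Pairing (C* C - t) x with x gives |C x|^2 - t |x|^2, so for negative \<open>t\<close>
  Cauchy-Schwarz yields the lower bound -t. All positivity of spectra below is obtained by
  exhibiting a Gram operator.\<close>

lemma real_spectrum_gram_nonneg:
  assumes C: "C \<in> bounded_ops" and t: "t \<in> real_spectrum (cadjoint C o\<^sub>L C)"
  shows "0 \<le> t"
proof (rule ccontr)
  have A: "self_adjoint_op (cadjoint C o\<^sub>L C)"
    using C by (simp add: self_adjoint_op_def cadjoint_compose)
  assume "\<not> 0 \<le> t"
  moreover have "(- t) * norm x \<le> norm (blinfun_apply (cadjoint C o\<^sub>L C) x - t *\<^sub>R x)"
    (is "_ \<le> norm ?y") for x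
  proof (cases "x = 0")
    case False
    have "cinner ?y x = of_real ((norm (blinfun_apply C x))\<^sup>2) - of_real t * of_real ((norm x)\<^sup>2)"
      using cinner_cadjoint'[OF C, of "blinfun_apply C x" x]
      by (simp add: cinner_diff_left scaleR_scaleC cinner_scaleC_left norm_cinner)
    then have "(- t) * norm x * norm x \<le> Re (cinner ?y x)"
      by (simp add: power2_eq_square)
    also have "\<dots> \<le> norm ?y * norm x"
      using cinner_Cauchy_Schwarz[of ?y x] complex_Re_le_cmod[of "cinner ?y x"] by linarith
    finally show ?thesis
      by (rule mult_right_le_imp_le) (use False in simp)
  qed simp
  ultimately show False
    using real_spectrum_bounded_below[OF A t, of "- t"] by simp
qed

text \<open>The Horner scheme with complex coefficients: \<open>op_poly\<close> takes real
  polynomials, which need not split into linear factors.\<close>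

definition cpoly_op :: "complex poly \<Rightarrow> ('h::chilbert_space \<Rightarrow>\<^sub>L 'h) \<Rightarrow> ('h \<Rightarrow>\<^sub>L 'h)" where
  "cpoly_op q A = fold_coeffs (\<lambda>a B. scalar_op a + (A o\<^sub>L B)) q 0"

lemma cpoly_op_0 [simp]: "cpoly_op 0 A = 0"
  by (simp add: cpoly_op_def)

lemma cpoly_op_pCons: "cpoly_op (pCons a q) A = scalar_op a + (A o\<^sub>L cpoly_op q A)"
  by (cases "q = 0 \<and> a = 0") (auto simp: cpoly_op_def scalar_op_simps)

lemma cpoly_op_add: "cpoly_op (p + q) A = cpoly_op p A + cpoly_op q A"
  by (induction p q rule: poly_induct2)
     (simp_all add: cpoly_op_pCons scalar_op_simps ocomp.add_right)

lemma cpoly_op_smult: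
  "A \<in> bounded_ops \<Longrightarrow> cpoly_op (smult c q) A = scalar_op c o\<^sub>L cpoly_op q A"
proof (induction q)
  case (pCons a q)
  then have "A o\<^sub>L cpoly_op (smult c q) A = scalar_op c o\<^sub>L (A o\<^sub>L cpoly_op q A)"
    by (metis ocomp_assoc scalar_op_commute)
  then show ?case
    by (simp add: cpoly_op_pCons scalar_op_simps ocomp.add_right)
qed simp

lemma cpoly_op_linear_factor:
  assumes "A \<in> bounded_ops"
  shows "cpoly_op ([:- z, 1:] * q) A = (A - scalar_op z) o\<^sub>L cpoly_op q A"
proof -
  have "[:- z, 1:] * q = smult (- z) q + pCons 0 q"
    by simp
  then show ?thesis
    using assms by (simp add: cpoly_op_add cpoly_op_smult cpoly_op_pCons scalar_op_simps
        scalar_op_minus ocomp.diff_left ocomp.minus_left del: smult_minus_left)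
qed

text \<open>The fundamental theorem of algebra splits off one linear factor at a time; what remains
  at degree 0 is a nonzero scalar, and products of invertible operators are invertible.\<close>

lemma cpoly_op_invertible:
  assumes A: "A \<in> bounded_ops" and "q \<noteq> 0"
    and "\<And>z. poly q z = 0 \<Longrightarrow> invertible_op (A - scalar_op z)"
  shows "invertible_op (cpoly_op q A)"
  using assms(2,3)
proof (induction "degree q" arbitrary: q rule: less_induct)
  case less
  show ?case
  proof (cases "degree q = 0")
    case True
    then obtain a where a: "q = [:a:]"
      by (auto elim: degree_eq_zeroE)
    then have "a \<noteq> 0"
      using less.prems by simp
    then show ?thesis
      unfolding a by (intro invertible_opI[of _ "scalar_op (inverse a)" "scalar_op (inverse a)"])
        (simp_all add: cpoly_op_pCons scalar_op_simps)
  next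
    case False
    then obtain z where z: "poly q z = 0"
      using fundamental_theorem_of_algebra[of q] by (auto simp: constant_degree)
    then obtain r where r: "q = [:- z, 1:] * r"
      unfolding poly_eq_0_iff_dvd by blast
    with \<open>q \<noteq> 0\<close> have "r \<noteq> 0"
      by auto
    then have "degree r < degree q"
      unfolding r by (subst degree_mult_eq) auto
    moreover have "invertible_op (A - scalar_op w)" if "poly r w = 0" for w
      using less.prems(2)[of w] that by (simp add: r)
    ultimately have "invertible_op (cpoly_op r A)"
      using less.hyps \<open>r \<noteq> 0\<close> by blast
    then show ?thesis
      unfolding r cpoly_op_linear_factor[OF A]
      using less.prems(2)[OF z] by (intro invertible_op_compose)
  qed
qed

section \<open>Continuous functional calculus\<close>

text \<open>The upper limit may exceed the degree, as happens for \<open>pCons a q\<close> with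
  \<open>q = 0\<close>.\<close>

lemma op_poly_sum:
  assumes "degree q \<le> n"
  shows "op_poly q A = (\<Sum>i\<le>n. coeff q i *\<^sub>R ((\<lambda>B. A o\<^sub>L B) ^^ i) id_blinfun)"
  unfolding op_poly_def
  by (rule sum.mono_neutral_left) (use assms in \<open>auto simp: coeff_eq_0\<close>)

lemma op_poly_0 [simp]: "op_poly 0 A = 0"
  by (simp add: op_poly_def)

lemma op_poly_pCons: "op_poly (pCons a q) A = a *\<^sub>R id_blinfun + (A o\<^sub>L op_poly q A)"
  by (subst op_poly_sum[OF degree_pCons_le], subst sum.atMost_Suc_shift)
     (simp add: op_poly_def ocomp.sum_right ocomp.scaleR_right)

lemma op_poly_monom: "op_poly (monom 1 k) A = ((\<lambda>B. A o\<^sub>L B) ^^ k) id_blinfun"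
  by (induction k) (simp_all add: monom_0 monom_Suc op_poly_pCons)

lemma op_poly_add: "op_poly (p + q) A = op_poly p A + op_poly q A"
  by (induction p q rule: poly_induct2)
     (simp_all add: op_poly_pCons ocomp.add_right scaleR_add_left)

lemma op_poly_smult: "op_poly (smult c q) A = c *\<^sub>R op_poly q A"
  by (induction q) (simp_all add: op_poly_pCons ocomp.scaleR_right scaleR_add_right)

lemma op_poly_diff: "op_poly (p - q) A = op_poly p A - op_poly q A"
  using op_poly_add[of p "smult (-1) q" A] op_poly_smult[of "-1" q A] by simp

lemma op_poly_mult: "op_poly (p * q) A = op_poly p A o\<^sub>L op_poly q A"
  by (induction p)
     (simp_all add: op_poly_pCons op_poly_add op_poly_smult ocomp.add_left ocomp.scaleR_left ocomp_assoc)

lemma op_poly_pcompose: "op_poly (pcompose p q) A = op_poly p (op_poly q A)"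
  by (induction p) (simp_all add: pcompose_pCons op_poly_pCons op_poly_add op_poly_mult)

lemma op_poly_commute: "A o\<^sub>L op_poly q A = op_poly q A o\<^sub>L A"
proof (induction q)
  case (pCons a q)
  then have "A o\<^sub>L (A o\<^sub>L op_poly q A) = (A o\<^sub>L op_poly q A) o\<^sub>L A"
    by (metis ocomp_assoc)
  then show ?case
    by (simp add: op_poly_pCons ocomp.add_left ocomp.add_right ocomp.scaleR_left ocomp.scaleR_right)
qed simp

lemma op_poly_cpoly_op: "op_poly q A = cpoly_op (map_poly complex_of_real q) A"
  by (induction q) (simp_all add: op_poly_pCons cpoly_op_pCons map_poly_pCons scalar_op_of_real)

lemma self_adjoint_op_add: "self_adjoint_op A \<Longrightarrow> self_adjoint_op B \<Longrightarrow> self_adjoint_op (A + B)"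
  and self_adjoint_op_diff: "self_adjoint_op A \<Longrightarrow> self_adjoint_op B \<Longrightarrow> self_adjoint_op (A - B)"
  and self_adjoint_op_scaleR: "self_adjoint_op A \<Longrightarrow> self_adjoint_op (r *\<^sub>R A)"
  and self_adjoint_op_id: "self_adjoint_op id_blinfun"
  by (simp_all add: self_adjoint_op_def cadjoint_add cadjoint_diff cadjoint_scaleR)

lemma self_adjoint_op_compose:
  "self_adjoint_op A \<Longrightarrow> self_adjoint_op B \<Longrightarrow> A o\<^sub>L B = B o\<^sub>L A \<Longrightarrow> self_adjoint_op (A o\<^sub>L B)"
  by (simp add: self_adjoint_op_def cadjoint_compose)

lemma self_adjoint_op_poly:
  assumes "self_adjoint_op A"
  shows "self_adjoint_op (op_poly q A)"
proof (induction q)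
  case 0
  then show ?case
    by (simp add: self_adjoint_op_def)
next
  case (pCons a q)
  then show ?case
    unfolding op_poly_pCons using assms
    by (intro self_adjoint_op_add self_adjoint_op_scaleR self_adjoint_op_id self_adjoint_op_compose
        op_poly_commute)
qed

text \<open>One direction of spectral mapping: some root of the complexified polynomial must be a
  spectral point, and spectral points of a self-adjoint operator are real, so it is a root of
  \<open>r\<close> itself.\<close>

lemma op_poly_not_invertible_root:
  assumes A: "self_adjoint_op A" and "r \<noteq> 0" and r: "\<not> invertible_op (op_poly r A)"
  shows "\<exists>t\<in>real_spectrum A. poly r t = 0"
proof -
  let ?r = "map_poly complex_of_real r"
  have "?r \<noteq> 0"
    using \<open>r \<noteq> 0\<close> by (subst map_poly_eq_0_iff) auto
  then obtain z where z: "poly ?r z = 0" "z \<in> op_spectrum A"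
    using cpoly_op_invertible[of A ?r] A r
    by (auto simp: op_spectrum_iff op_poly_cpoly_op self_adjoint_op_def)
  then have "z = complex_of_real (Re z)"
    using op_spectrum_self_adjoint_real[OF A] by (simp add: complex_eq_iff)
  moreover have "poly ?r (complex_of_real t) = complex_of_real (poly r t)" for t
    by (induction r) (simp_all add: map_poly_pCons)
  ultimately show ?thesis
    using z by (metis (mono_tags, lifting) mem_Collect_eq of_real_eq_0_iff real_spectrum_def)
qed

text \<open>Takes the place of the spectral radius formula: |B| attains its norm on the spectrum.
  With m = |B| and T = B^2 - m^2, expanding gives |T x|^2 <= m^2 (m^2 |x|^2 - |B x|^2). A left
  inverse C of T bounds |T x| below by |x| / |C|, hence |B x|^2 <= k |x|^2 with k < m^2,
  contradicting the definition of m.\<close>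

lemma square_minus_norm_not_invertible:
  fixes B :: "'h::chilbert_space \<Rightarrow>\<^sub>L 'h"
  assumes B: "self_adjoint_op B" and nz: "(id_blinfun :: 'h \<Rightarrow>\<^sub>L 'h) \<noteq> 0"
  shows "\<not> invertible_op ((B o\<^sub>L B) - (norm B)\<^sup>2 *\<^sub>R id_blinfun)"
proof
  define m where "m = norm B"
  define T where "T = (B o\<^sub>L B) - m\<^sup>2 *\<^sub>R id_blinfun"
  assume "invertible_op ((B o\<^sub>L B) - (norm B)\<^sup>2 *\<^sub>R id_blinfun)"
  then obtain C where C: "C o\<^sub>L T = id_blinfun"
    by (auto simp: invertible_op_def T_def m_def)
  have "m \<noteq> 0"
  proof
    assume "m = 0"
    then have "T = 0"
      by (simp add: T_def m_def)
    then show False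
      using C nz by simp
  qed
  then have "m > 0"
    by (simp add: m_def)
  have "C \<noteq> 0"
    using C nz by auto
  define k where "k = m\<^sup>2 - 1 / ((norm C)\<^sup>2 * m\<^sup>2)"
  have key: "(norm (blinfun_apply B x))\<^sup>2 \<le> k * (norm x)\<^sup>2" for x
  proof -
    have "blinfun_apply C (blinfun_apply T x) = x"
      by (metis C blinfun_apply_blinfun_compose blinfun_apply_id_blinfun)
    then have "norm x \<le> norm C * norm (blinfun_apply T x)"
      by (metis norm_blinfun)
    then have "(norm x)\<^sup>2 \<le> (norm C * norm (blinfun_apply T x))\<^sup>2"
      by (intro power_mono) auto
    then have 1: "(norm x)\<^sup>2 \<le> (norm C)\<^sup>2 * (norm (blinfun_apply T x))\<^sup>2"
      by (simp add: power_mult_distrib)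
    have "norm (blinfun_apply B (blinfun_apply B x)) \<le> m * norm (blinfun_apply B x)"
      unfolding m_def by (rule norm_blinfun)
    then have "(norm (blinfun_apply B (blinfun_apply B x)))\<^sup>2 \<le> (m * norm (blinfun_apply B x))\<^sup>2"
      by (intro power_mono) auto
    then have 2: "(norm (blinfun_apply B (blinfun_apply B x)))\<^sup>2 \<le> m\<^sup>2 * (norm (blinfun_apply B x))\<^sup>2"
      by (simp add: power_mult_distrib)
    have "cinner (blinfun_apply B (blinfun_apply B x)) x = of_real ((norm (blinfun_apply B x))\<^sup>2)"
      using self_adjoint_op_cinner[OF B, of "blinfun_apply B x" x] by (simp add: norm_cinner)
    then have "Re (cinner (blinfun_apply B (blinfun_apply B x)) (m\<^sup>2 *\<^sub>R x))
        = m\<^sup>2 * (norm (blinfun_apply B x))\<^sup>2"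
      by (simp add: scaleR_scaleC cinner_scaleC_right flip: of_real_power of_real_mult)
    then have "(norm (blinfun_apply T x))\<^sup>2 = (norm (blinfun_apply B (blinfun_apply B x)))\<^sup>2
        - 2 * (m\<^sup>2 * (norm (blinfun_apply B x))\<^sup>2) + (m\<^sup>2)\<^sup>2 * (norm x)\<^sup>2"
      unfolding T_def by (simp add: blinfun.diff_left blinfun.scaleR_left norm_diff_sq power_mult_distrib)
    also have "\<dots> \<le> m\<^sup>2 * (m\<^sup>2 * (norm x)\<^sup>2 - (norm (blinfun_apply B x))\<^sup>2)"
      using 2 by (simp add: algebra_simps power2_eq_square)
    finally have "(norm x)\<^sup>2 \<le> (norm C)\<^sup>2 * (m\<^sup>2 * (m\<^sup>2 * (norm x)\<^sup>2 - (norm (blinfun_apply B x))\<^sup>2))"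
      by (intro order_trans[OF 1] mult_left_mono) auto
    then have "(norm x)\<^sup>2 / ((norm C)\<^sup>2 * m\<^sup>2) \<le> m\<^sup>2 * (norm x)\<^sup>2 - (norm (blinfun_apply B x))\<^sup>2"
      using \<open>m > 0\<close> \<open>C \<noteq> 0\<close> by (simp add: pos_divide_le_eq mult_ac)
    then show ?thesis
      by (simp add: k_def left_diff_distrib)
  qed
  obtain x :: 'h where "x \<noteq> 0"
    using nz by (metis blinfun_apply_id_blinfun blinfun_eqI zero_blinfun.rep_eq)
  have "0 \<le> k * (norm x)\<^sup>2"
    using key[of x] by (meson order_trans zero_le_power2)
  then have "0 \<le> k"
    using \<open>x \<noteq> 0\<close> by (simp add: zero_le_mult_iff)
  have "norm (blinfun_apply B x) \<le> sqrt k * norm x" for x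
    using key[of x] \<open>0 \<le> k\<close>
    by - (rule power2_le_imp_le, simp_all add: power_mult_distrib)
  then have "m \<le> sqrt k"
    unfolding m_def using \<open>0 \<le> k\<close> by (intro norm_blinfun_bound) auto
  then have "m\<^sup>2 \<le> k"
    using \<open>m > 0\<close> \<open>0 \<le> k\<close> by (metis real_le_rsqrt real_sqrt_le_iff real_sqrt_unique less_imp_le)
  moreover have "0 < 1 / ((norm C)\<^sup>2 * m\<^sup>2)"
    using \<open>m > 0\<close> \<open>C \<noteq> 0\<close> by simp
  ultimately show False
    by (simp add: k_def)
qed

text \<open>The non-invertible operator \<open>q(A)\<^sup>2 - \<parallel>q(A)\<parallel>\<^sup>2\<close> is a polynomial in \<open>A\<close>, which therefore has a root in
  the spectrum; there \<open>|q|\<close> takes the value \<open>\<parallel>q(A)\<parallel>\<close>.\<close>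

lemma norm_op_poly_le:
  fixes A :: "'h::chilbert_space \<Rightarrow>\<^sub>L 'h"
  assumes A: "self_adjoint_op A" and M: "\<And>t. t \<in> real_spectrum A \<Longrightarrow> \<bar>poly q t\<bar> \<le> M" and "0 \<le> M"
  shows "norm (op_poly q A) \<le> M"
\<comment> \<open>On the zero space the spectrum is empty and the bound on it says nothing;
  \<open>0 \<le> M\<close> covers this case.\<close>
proof (cases "(id_blinfun :: 'h \<Rightarrow>\<^sub>L 'h) = 0")
  case True
  then have "op_poly q A = 0"
    by (metis ocomp_id(1) blinfun_compose_zero(2))
  then show ?thesis
    using \<open>0 \<le> M\<close> by simp
next
  case False
  have root: "\<exists>t\<in>real_spectrum A. (poly p t)\<^sup>2 = (norm (op_poly p A))\<^sup>2"
    if "p * p \<noteq> [:(norm (op_poly p A))\<^sup>2:]" for p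
  proof -
    let ?r = "p * p - [:(norm (op_poly p A))\<^sup>2:]"
    have "op_poly ?r A = (op_poly p A o\<^sub>L op_poly p A) - (norm (op_poly p A))\<^sup>2 *\<^sub>R id_blinfun"
      by (simp add: op_poly_diff op_poly_mult op_poly_pCons)
    then have "\<not> invertible_op (op_poly ?r A)"
      using square_minus_norm_not_invertible[OF self_adjoint_op_poly[OF A] False] by simp
    moreover have "?r \<noteq> 0"
      using that by simp
    ultimately obtain t where "t \<in> real_spectrum A" "poly ?r t = 0"
      using op_poly_not_invertible_root[OF A] by blast
    then show ?thesis
      by (auto simp: power2_eq_square)
  qed
  have "\<exists>t\<in>real_spectrum A. (poly q t)\<^sup>2 = (norm (op_poly q A))\<^sup>2"
  \<comment> \<open>If q^2 is this constant, the polynomial used in \<open>root\<close> vanishes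
    identically. Then any spectral point will do, and one exists because \<open>root\<close> applies
    to the polynomial [:0, 1:], whose square is not constant.\<close>
  proof (cases "q * q = [:(norm (op_poly q A))\<^sup>2:]")
    case True
    then have "poly (q * q) t = (norm (op_poly q A))\<^sup>2" for t
      by simp
    moreover obtain t where "t \<in> real_spectrum A"
      using root[of "[:0, 1:]"] by auto
    ultimately show ?thesis
      by (auto simp: power2_eq_square)
  qed (rule root)
  then obtain t where t: "t \<in> real_spectrum A" "(poly q t)\<^sup>2 = (norm (op_poly q A))\<^sup>2"
    by blast
  then have "norm (op_poly q A) = \<bar>poly q t\<bar>"
    by (metis abs_norm_cancel power2_eq_iff abs_minus_cancel)
  then show ?thesis
    using M t by simp
qed

lemma poly_approx:
  fixes f :: "real \<Rightarrow> real"
  assumes "continuous_on {a..b} f"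
  shows "\<exists>q. uniform_limit {a..b} (\<lambda>n. poly (q n)) f sequentially"
proof -
  have "\<exists>q. \<forall>x\<in>{a..b}. \<bar>f x - poly q x\<bar> < inverse (real (Suc n))" for n
  proof -
    obtain g where g: "real_polynomial_function g"
      "\<And>x. x \<in> {a..b} \<Longrightarrow> \<bar>f x - g x\<bar> < inverse (real (Suc n))"
      using Stone_Weierstrass_real_polynomial_function[OF compact_Icc assms, of "inverse (real (Suc n))"]
      by auto
    then obtain c m where c: "g = (\<lambda>x. \<Sum>i\<le>m. c i * x ^ i)"
      using real_polynomial_function_iff_sum by auto
    have "poly (\<Sum>i\<le>m. monom (c i) i) x = g x" for x
      by (simp add: c poly_sum poly_monom)
    then show ?thesis
      using g(2) by metis
  qed
  then obtain q where q: "\<And>n x. x \<in> {a..b} \<Longrightarrow> \<bar>f x - poly (q n) x\<bar> < inverse (real (Suc n))"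
    by metis
  have "uniform_limit {a..b} (\<lambda>n. poly (q n)) f sequentially"
    unfolding uniform_limit_iff
  proof (intro allI impI)
    fix e :: real
    assume "e > 0"
    then obtain M where M: "inverse (real (Suc M)) < e"
      using reals_Archimedean by blast
    have "dist (poly (q n) x) (f x) < e" if "n \<ge> M" "x \<in> {a..b}" for n x
    proof -
      have "inverse (real (Suc n)) \<le> inverse (real (Suc M))"
        using that by (auto intro: le_imp_inverse_le)
      then show ?thesis
        using q[OF that(2), of n] M unfolding dist_real_def by linarith
    qed
    then show "\<forall>\<^sub>F n in sequentially. \<forall>x\<in>{a..b}. dist (poly (q n) x) (f x) < e"
      unfolding eventually_sequentially by blast
  qed
  then show ?thesis
    by blast
qed

text \<open>Taken with \<open>p = q\<close> it is the Cauchy property, hence existence of the limit;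
  with different sequences it shows that the limit does not depend on the choice.\<close>

lemma op_poly_diff_tendsto_0:
  assumes A: "self_adjoint_op A"
    and p: "uniform_limit (real_spectrum A) (\<lambda>n. poly (p n)) f sequentially"
    and q: "uniform_limit (real_spectrum A) (\<lambda>n. poly (q n)) f sequentially"
    and "e > 0"
  shows "\<exists>M. \<forall>m\<ge>M. \<forall>n\<ge>M. norm (op_poly (p m) A - op_poly (q n) A) < e"
proof -
  have "e / 4 > 0"
    using \<open>e > 0\<close> by simp
  obtain M1 where M1: "\<And>n t. n \<ge> M1 \<Longrightarrow> t \<in> real_spectrum A \<Longrightarrow> dist (poly (p n) t) (f t) < e / 4"
    using uniform_limitD[OF p \<open>e / 4 > 0\<close>] unfolding eventually_sequentially by blast
  obtain M2 where M2: "\<And>n t. n \<ge> M2 \<Longrightarrow> t \<in> real_spectrum A \<Longrightarrow> dist (poly (q n) t) (f t) < e / 4"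
    using uniform_limitD[OF q \<open>e / 4 > 0\<close>] unfolding eventually_sequentially by blast
  have "norm (op_poly (p m) A - op_poly (q n) A) < e" if "m \<ge> max M1 M2" "n \<ge> max M1 M2" for m n
  proof -
    have "norm (op_poly (p m - q n) A) \<le> e / 2"
    proof (rule norm_op_poly_le[OF A])
      fix t assume "t \<in> real_spectrum A"
      then have "\<bar>poly (p m) t - f t\<bar> < e / 4" "\<bar>poly (q n) t - f t\<bar> < e / 4"
        using M1[of m t] M2[of n t] that by (auto simp: dist_real_def)
      then show "\<bar>poly (p m - q n) t\<bar> \<le> e / 2"
        unfolding poly_diff by linarith
    qed (use \<open>e > 0\<close> in simp)
    then show ?thesis
      using \<open>e > 0\<close> by (simp add: op_poly_diff)
  qed
  then show ?thesis
    by blast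
qed

text \<open>The sequence \<open>q\<close> also secures uniqueness in the definite description: if
  nothing converged to \<open>f\<close>, every operator would satisfy its condition
  vacuously.\<close>

lemma cfc_tendsto:
  assumes A: "self_adjoint_op A"
    and q: "uniform_limit (real_spectrum A) (\<lambda>n. poly (q n)) f sequentially"
  shows "(\<lambda>n. op_poly (q n) A) \<longlonglongrightarrow> cfc f A"
proof -
  have "Cauchy (\<lambda>n. op_poly (q n) A)"
    using op_poly_diff_tendsto_0[OF A q q] by (intro metric_CauchyI) (simp add: dist_norm)
  then obtain B where B: "(\<lambda>n. op_poly (q n) A) \<longlonglongrightarrow> B"
    using Cauchy_convergent convergent_def by blast
  have lim: "(\<lambda>n. op_poly (p n) A) \<longlonglongrightarrow> B"
    if p: "uniform_limit (real_spectrum A) (\<lambda>n. poly (p n)) f sequentially" for p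
  proof -
    have "(\<lambda>n. op_poly (p n) A - op_poly (q n) A) \<longlonglongrightarrow> 0"
    proof (rule LIMSEQ_I)
      fix e :: real
      assume "e > 0"
      then show "\<exists>M. \<forall>n\<ge>M. norm (op_poly (p n) A - op_poly (q n) A - 0) < e"
        using op_poly_diff_tendsto_0[OF A p q, of e] by auto
    qed
    from tendsto_add[OF this B] show ?thesis
      by simp
  qed
  have "cfc f A = B"
    unfolding cfc_def real_spectrum_def[symmetric]
  proof (rule the_equality)
    show "\<forall>p. uniform_limit (real_spectrum A) (\<lambda>n. poly (p n)) f sequentially \<longrightarrow>
        (\<lambda>n. op_poly (p n) A) \<longlonglongrightarrow> B"
      using lim by blast
  next
    fix C
    assume "\<forall>p. uniform_limit (real_spectrum A) (\<lambda>n. poly (p n)) f sequentially \<longrightarrow>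
        (\<lambda>n. op_poly (p n) A) \<longlonglongrightarrow> C"
    then have "(\<lambda>n. op_poly (q n) A) \<longlonglongrightarrow> C"
      using q by blast
    then show "C = B"
      using B by (rule LIMSEQ_unique)
  qed
  then show ?thesis
    using B by simp
qed

lemma bounded_bilinear_cinner: "bounded_bilinear (cinner :: 'h::chilbert_space \<Rightarrow> 'h \<Rightarrow> complex)"
proof
  show "\<exists>K. \<forall>a b::'h. norm (cinner a b) \<le> norm a * norm b * K"
    by (intro exI[of _ 1]) (simp add: cinner_Cauchy_Schwarz)
qed (simp_all add: cinner_add_left cinner_add_right scaleR_scaleC cinner_scaleC_left
    cinner_scaleC_right scaleR_conv_of_real)

lemma self_adjoint_op_tendsto:
  assumes B: "\<And>n. self_adjoint_op (B n)" and lim: "B \<longlonglongrightarrow> C"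
  shows "self_adjoint_op C"
proof -
  have app: "(\<lambda>n. blinfun_apply (B n) x) \<longlonglongrightarrow> blinfun_apply C x" for x
    by (intro blinfun.tendsto lim tendsto_const)
  have "blinfun_apply C (c *\<^sub>C x) = c *\<^sub>C blinfun_apply C x" for c x
  proof (rule LIMSEQ_unique[OF app])
    have "(\<lambda>n. blinfun_apply (scalar_op c) (blinfun_apply (B n) x))
        \<longlonglongrightarrow> blinfun_apply (scalar_op c) (blinfun_apply C x)"
      by (intro blinfun.tendsto app tendsto_const)
    then show "(\<lambda>n. blinfun_apply (B n) (c *\<^sub>C x)) \<longlonglongrightarrow> c *\<^sub>C blinfun_apply C x"
      using B by (simp add: self_adjoint_op_def bounded_ops_scaleC)
  qed
  moreover have "cadjoint C = C"
  proof (rule cadjoint_unique)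
    fix x y
    have "(\<lambda>n. cinner (blinfun_apply (B n) x) y) \<longlonglongrightarrow> cinner (blinfun_apply C x) y"
      "(\<lambda>n. cinner x (blinfun_apply (B n) y)) \<longlonglongrightarrow> cinner x (blinfun_apply C y)"
      by (intro bounded_bilinear.tendsto[OF bounded_bilinear_cinner] app tendsto_const)+
    then show "cinner (blinfun_apply C x) y = cinner x (blinfun_apply C y)"
      using B by (simp add: self_adjoint_op_cinner LIMSEQ_unique)
  qed
  ultimately show ?thesis
    by (simp add: self_adjoint_op_def bounded_ops_def)
qed

context
  fixes A :: "'h::chilbert_space \<Rightarrow>\<^sub>L 'h" and a b :: real
  assumes A: "self_adjoint_op A" and spectrum: "real_spectrum A \<subseteq> {a..b}"
begin

text \<open>Approximation takes place on an interval enclosing the spectrum, where Weierstrass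
  applies, and is then restricted to the spectrum.\<close>

lemma cfc_tendsto_interval:
  assumes "uniform_limit {a..b} (\<lambda>n. poly (q n)) f sequentially"
  shows "(\<lambda>n. op_poly (q n) A) \<longlonglongrightarrow> cfc f A"
  by (rule cfc_tendsto[OF A uniform_limit_on_subset[OF assms spectrum]])

lemma cfc_self_adjoint:
  assumes "continuous_on {a..b} f"
  shows "self_adjoint_op (cfc f A)"
proof -
  obtain q where "uniform_limit {a..b} (\<lambda>n. poly (q n)) f sequentially"
    using poly_approx[OF assms] by blast
  from self_adjoint_op_tendsto[OF self_adjoint_op_poly[OF A] cfc_tendsto_interval[OF this]]
  show ?thesis .
qed

lemma cfc_mem:
  assumes "continuous_on {a..b} f" and "closed N" and "\<And>q. op_poly q A \<in> N"
  shows "cfc f A \<in> N"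
proof -
  obtain q where "uniform_limit {a..b} (\<lambda>n. poly (q n)) f sequentially"
    using poly_approx[OF assms(1)] by blast
  from closed_sequentially[OF assms(2) assms(3) cfc_tendsto_interval[OF this]] show ?thesis .
qed

lemma cfc_mult:
  assumes f: "continuous_on {a..b} f" and g: "continuous_on {a..b} g"
  shows "cfc (\<lambda>t. f t * g t) A = cfc f A o\<^sub>L cfc g A"
proof -
  obtain p where p: "uniform_limit {a..b} (\<lambda>n. poly (p n)) f sequentially"
    using poly_approx[OF f] by blast
  obtain q where q: "uniform_limit {a..b} (\<lambda>n. poly (q n)) g sequentially"
    using poly_approx[OF g] by blast
  have "bounded (f ` {a..b})" "bounded (g ` {a..b})"
    using f g by (auto intro!: compact_imp_bounded compact_continuous_image)
  then have "uniform_limit {a..b} (\<lambda>n. poly (p n * q n)) (\<lambda>t. f t * g t) sequentially"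
    using uniform_lim_mult[OF p q] by (simp add: poly_mult[abs_def])
  from cfc_tendsto_interval[OF this]
  have "(\<lambda>n. op_poly (p n) A o\<^sub>L op_poly (q n) A) \<longlonglongrightarrow> cfc (\<lambda>t. f t * g t) A"
    by (simp add: op_poly_mult)
  moreover have "(\<lambda>n. op_poly (p n) A o\<^sub>L op_poly (q n) A) \<longlonglongrightarrow> (cfc f A o\<^sub>L cfc g A)"
    by (intro ocomp.tendsto cfc_tendsto_interval p q)
  ultimately show ?thesis
    by (rule LIMSEQ_unique)
qed

lemma cfc_diff:
  assumes f: "continuous_on {a..b} f" and g: "continuous_on {a..b} g"
  shows "cfc (\<lambda>t. f t - g t) A = cfc f A - cfc g A"
proof -
  obtain p where p: "uniform_limit {a..b} (\<lambda>n. poly (p n)) f sequentially"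
    using poly_approx[OF f] by blast
  obtain q where q: "uniform_limit {a..b} (\<lambda>n. poly (q n)) g sequentially"
    using poly_approx[OF g] by blast
  have "uniform_limit {a..b} (\<lambda>n. poly (p n - q n)) (\<lambda>t. f t - g t) sequentially"
    using uniform_limit_minus[OF p q] by (simp add: poly_diff[abs_def])
  from cfc_tendsto_interval[OF this]
  have "(\<lambda>n. op_poly (p n) A - op_poly (q n) A) \<longlonglongrightarrow> cfc (\<lambda>t. f t - g t) A"
    by (simp add: op_poly_diff)
  moreover have "(\<lambda>n. op_poly (p n) A - op_poly (q n) A) \<longlonglongrightarrow> cfc f A - cfc g A"
    by (intro tendsto_intros cfc_tendsto_interval p q)
  ultimately show ?thesis
    by (rule LIMSEQ_unique)
qed

lemma cfc_eq_poly:
  assumes "\<And>t. t \<in> {a..b} \<Longrightarrow> f t = poly q t"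
  shows "cfc f A = op_poly q A"
proof -
  have "uniform_limit {a..b} (\<lambda>n. poly q) f sequentially"
    using assms by (auto simp: uniform_limit_iff)
  from cfc_tendsto_interval[OF this] show ?thesis
    by (simp add: LIMSEQ_const_iff)
qed

text \<open>The witness is the pointwise square root. As g(A) is self-adjoint, f(A) becomes a Gram
  operator, to which positivity of spectrum and trace apply.\<close>

lemma cfc_square_root:
  assumes f: "continuous_on {a..b} f" and "\<And>t. t \<in> {a..b} \<Longrightarrow> 0 \<le> f t"
  shows "\<exists>g. continuous_on {a..b} g \<and> cfc f A = cfc g A o\<^sub>L cfc g A"
proof -
  have cont: "continuous_on {a..b} (\<lambda>t. sqrt (f t))"
    by (intro continuous_intros f)
  obtain p where p: "uniform_limit {a..b} (\<lambda>n. poly (p n)) f sequentially"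
    using poly_approx[OF f] by blast
  \<comment> \<open>\<open>f\<close> and the square of its root are only known to agree on the
    interval. One approximating sequence serves both, so both calculi have the same limit.\<close>
  then have "uniform_limit {a..b} (\<lambda>n. poly (p n)) (\<lambda>t. sqrt (f t) * sqrt (f t)) sequentially"
    by (rule uniform_limit_cong'[THEN iffD1, rotated 2]) (use assms in auto)
  from LIMSEQ_unique[OF cfc_tendsto_interval[OF p] cfc_tendsto_interval[OF this]]
  show ?thesis
    using cfc_mult[OF cont cont] cont by auto
qed

lemma norm_cfc_diff_poly_le:
  assumes f: "continuous_on {a..b} f" and "\<And>t. t \<in> {a..b} \<Longrightarrow> \<bar>f t - poly q t\<bar> \<le> e" and "0 \<le> e"
  shows "norm (cfc f A - op_poly q A) \<le> e"
proof (rule field_le_epsilon)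
  fix d :: real
  assume "d > 0"
  obtain p where p: "uniform_limit {a..b} (\<lambda>n. poly (p n)) f sequentially"
    using poly_approx[OF f] by blast
  have "\<forall>\<^sub>F n in sequentially. norm (op_poly (p n) A - op_poly q A) \<le> e + d"
    using uniform_limitD[OF p \<open>d > 0\<close>]
  proof (rule eventually_mono)
    fix n assume n: "\<forall>t\<in>{a..b}. dist (poly (p n) t) (f t) < d"
    have "norm (op_poly (p n - q) A) \<le> e + d"
    proof (rule norm_op_poly_le[OF A])
      fix t assume "t \<in> real_spectrum A"
      then have "t \<in> {a..b}"
        using spectrum by blast
      then have "\<bar>poly (p n) t - f t\<bar> < d" "\<bar>f t - poly q t\<bar> \<le> e"
        using n assms(2)[of t] by (auto simp: dist_real_def)
      then show "\<bar>poly (p n - q) t\<bar> \<le> e + d"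
        unfolding poly_diff by linarith
    qed (use \<open>d > 0\<close> \<open>0 \<le> e\<close> in simp)
    then show "norm (op_poly (p n) A - op_poly q A) \<le> e + d"
      by (simp add: op_poly_diff)
  qed
  moreover have "(\<lambda>n. norm (op_poly (p n) A - op_poly q A)) \<longlonglongrightarrow> norm (cfc f A - op_poly q A)"
    by (intro tendsto_intros cfc_tendsto_interval p)
  ultimately show "norm (cfc f A - op_poly q A) \<le> e + d"
    by (intro tendsto_upperbound) auto
qed

end

lemma continuous_on_powr_nonneg: "0 < s \<Longrightarrow> continuous_on {0..b::real} (\<lambda>t. t powr s)"
  by (intro continuous_on_powr' continuous_intros) auto

text \<open>For the last claim the root is itself written as a square, by
  \<open>cfc_square_root\<close> applied to \<open>sqrt\<close>; being a Gram operator it has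
  nonnegative spectrum.\<close>

lemma cfc_sqrt:
  assumes A: "self_adjoint_op A" and sp: "real_spectrum A \<subseteq> {0..b}"
  shows "self_adjoint_op (cfc sqrt A)" and "cfc sqrt A o\<^sub>L cfc sqrt A = A"
    and "real_spectrum (cfc sqrt A) \<subseteq> {0..norm (cfc sqrt A)}"
proof -
  have cont: "continuous_on {0..b} sqrt"
    by (intro continuous_intros)
  show sa: "self_adjoint_op (cfc sqrt A)"
    by (rule cfc_self_adjoint[OF A sp cont])
  have "cfc (\<lambda>t. sqrt t * sqrt t) A = op_poly [:0, 1:] A"
    by (rule cfc_eq_poly[OF A sp]) simp
  then show "cfc sqrt A o\<^sub>L cfc sqrt A = A"
    using cfc_mult[OF A sp cont cont] by (simp add: op_poly_pCons)
  obtain g where g: "continuous_on {0..b} g" "cfc sqrt A = cfc g A o\<^sub>L cfc g A"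
    using cfc_square_root[OF A sp cont] by auto
  have "0 \<le> t" if "t \<in> real_spectrum (cfc sqrt A)" for t
    using that cfc_self_adjoint[OF A sp g(1)] real_spectrum_gram_nonneg[of "cfc g A" t]
    by (simp add: g(2) self_adjoint_op_def)
  then show "real_spectrum (cfc sqrt A) \<subseteq> {0..norm (cfc sqrt A)}"
    using real_spectrum_le_norm[OF sa] by fastforce
qed

text \<open>Reduces |C|^p to (C* C)^(p/2). If q_n approximates t^(p/2), then q_n(t^2) approximates
  t^p, and both give the same operators because the square of \<open>cfc sqrt A\<close> is
  \<open>A\<close>.\<close>

lemma cfc_powr_sqrt:
  assumes A: "self_adjoint_op A" and sp: "real_spectrum A \<subseteq> {0..b}" and "0 < p"
  shows "cfc (\<lambda>t. t powr p) (cfc sqrt A) = cfc (\<lambda>t. t powr (p / 2)) A"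
proof -
  define B where "B = cfc sqrt A"
  note B = cfc_sqrt[OF A sp, folded B_def]
  \<comment> \<open>Large enough that [0, K] contains the spectrum of \<open>B\<close>; the summand
    1 gives K <= K^2, so that [0, K^2] contains the spectrum of \<open>A\<close> as well as all
    squares of points of [0, K].\<close>
  define K where "K = norm B + \<bar>b\<bar> + 1"
  have "1 \<le> K" "\<bar>b\<bar> \<le> K" "norm B \<le> K"
    by (auto simp: K_def)
  then have "K \<le> K\<^sup>2"
    by (simp add: power2_eq_square mult_le_cancel_left1)
  then have spK: "real_spectrum A \<subseteq> {0..K\<^sup>2}"
    using sp \<open>\<bar>b\<bar> \<le> K\<close> by fastforce
  have spB: "real_spectrum B \<subseteq> {0..K}"
    using B(3) \<open>norm B \<le> K\<close> by fastforce
  obtain q where q: "uniform_limit {0..K\<^sup>2} (\<lambda>n. poly (q n)) (\<lambda>t. t powr (p / 2)) sequentially"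
    using poly_approx continuous_on_powr_nonneg \<open>0 < p\<close> by (metis half_gt_zero)
  have "uniform_limit {0..K} (\<lambda>n t. poly (q n) (t\<^sup>2)) (\<lambda>t. t\<^sup>2 powr (p / 2)) sequentially"
    by (rule uniform_limit_compose'[OF q]) (auto intro: power_mono)
  then have "uniform_limit {0..K} (\<lambda>n t. poly (q n) (t\<^sup>2)) (\<lambda>t. t powr p) sequentially"
    by (rule uniform_limit_cong'[THEN iffD1, rotated 2])
       (auto simp: powr_powr simp flip: powr_numeral)
  moreover have "poly (q n) (t\<^sup>2) = poly (pcompose (q n) [:0, 0, 1:]) t" for n t
    by (simp add: poly_pcompose power2_eq_square)
  ultimately have "(\<lambda>n. op_poly (pcompose (q n) [:0, 0, 1:]) B) \<longlonglongrightarrow> cfc (\<lambda>t. t powr p) B"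
    by (intro cfc_tendsto_interval[OF B(1) spB]) simp
  moreover have "op_poly (pcompose (q n) [:0, 0, 1:]) B = op_poly (q n) A" for n
    by (simp add: op_poly_pcompose op_poly_pCons B(2))
  ultimately show ?thesis
    using LIMSEQ_unique cfc_tendsto_interval[OF A spK q] unfolding B_def by auto
qed

section \<open>Von Neumann algebras and traces\<close>

lemma commutant_add: "A \<in> commutant S \<Longrightarrow> B \<in> commutant S \<Longrightarrow> A + B \<in> commutant S"
  and commutant_diff: "A \<in> commutant S \<Longrightarrow> B \<in> commutant S \<Longrightarrow> A - B \<in> commutant S"
  by (auto simp: commutant_def ocomp.add_left ocomp.add_right ocomp.diff_left ocomp.diff_right)

lemma commutant_compose: "A \<in> commutant S \<Longrightarrow> B \<in> commutant S \<Longrightarrow> A o\<^sub>L B \<in> commutant S"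
  unfolding commutant_def by clarsimp (metis ocomp_assoc)

lemma commutant_scalar_op: "S \<subseteq> bounded_ops \<Longrightarrow> scalar_op c \<in> commutant S"
  by (auto simp: commutant_def scalar_op_commute)

lemma closed_commutant:
  fixes S :: "('h::chilbert_space \<Rightarrow>\<^sub>L 'h) set"
  shows "closed (commutant S)"
proof -
  have eq: "commutant S =
      {B. \<forall>c x. blinfun_apply B (c *\<^sub>C x) = blinfun_apply (scalar_op c) (blinfun_apply B x)}
      \<inter> (\<Inter>A\<in>S. {B. A o\<^sub>L B = B o\<^sub>L A})"
    by (auto simp: commutant_def bounded_ops_def)
  show ?thesis
    unfolding eq
    by (intro closed_Int closed_INT ballI closed_Collect_all closed_Collect_eq ocomp.continuous_on
        continuous_intros)
qed

section \<open>Closure properties of a von Neumann algebra and its kernel projections\<close>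

locale von_neumann =
  fixes N :: "('h::chilbert_space \<Rightarrow>\<^sub>L 'h) set"
  assumes vn: "von_neumann_algebra N"
begin

lemma bounded_mem [simp]: "A \<in> N \<Longrightarrow> A \<in> bounded_ops"
  using vn by (auto simp: von_neumann_algebra_def)

lemma adjoint_mem [simp]: "A \<in> N \<Longrightarrow> cadjoint A \<in> N"
  using vn by (auto simp: von_neumann_algebra_def)

lemma bicommutant: "commutant (commutant N) = N"
  using vn by (auto simp: von_neumann_algebra_def)

lemma closed_N: "closed N"
  using closed_commutant[of "commutant N"] by (simp add: bicommutant)

lemma add_mem [simp]: "A \<in> N \<Longrightarrow> B \<in> N \<Longrightarrow> A + B \<in> N"
  and diff_mem [simp]: "A \<in> N \<Longrightarrow> B \<in> N \<Longrightarrow> A - B \<in> N"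
  and compose_mem [simp]: "A \<in> N \<Longrightarrow> B \<in> N \<Longrightarrow> A o\<^sub>L B \<in> N"
  using commutant_add[of A "commutant N" B] commutant_diff[of A "commutant N" B]
    commutant_compose[of A "commutant N" B] by (simp_all add: bicommutant)

lemma scalar_op_mem [simp]: "scalar_op c \<in> N"
proof -
  have "commutant N \<subseteq> bounded_ops"
    by (auto simp: commutant_def)
  from commutant_scalar_op[OF this, of c] show ?thesis
    by (simp add: bicommutant)
qed

lemma id_mem [simp]: "id_blinfun \<in> N"
  using scalar_op_mem[of 1] by (simp add: scalar_op_simps)

lemma scaleR_conv: "r *\<^sub>R A = scalar_op (complex_of_real r) o\<^sub>L A"
  by (simp add: scalar_op_of_real ocomp.scaleR_left)

lemma scaleR_mem [simp]: "A \<in> N \<Longrightarrow> r *\<^sub>R A \<in> N"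
  by (simp add: scaleR_conv)

lemma zero_mem [simp]: "0 \<in> N"
  using scaleR_mem[OF id_mem, of 0] by simp

lemma op_poly_mem [simp]: "A \<in> N \<Longrightarrow> op_poly q A \<in> N"
  by (induction q) (simp_all add: op_poly_pCons)

lemma funpow_mem [simp]: "A \<in> N \<Longrightarrow> ((\<lambda>B. A o\<^sub>L B) ^^ k) id_blinfun \<in> N"
  by (induction k) simp_all

lemma cfc_mem_N:
  assumes "A \<in> N" "self_adjoint_op A" "real_spectrum A \<subseteq> {a..b}" "continuous_on {a..b} f"
  shows "cfc f A \<in> N"
  using assms by (intro cfc_mem[OF assms(2,3,4) closed_N]) simp

lemma adjoint_commutant:
  assumes "B \<in> commutant N"
  shows "cadjoint B \<in> commutant N"
proof -
  have B: "B \<in> bounded_ops"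
    using assms by (simp add: commutant_def)
  have "A o\<^sub>L cadjoint B = cadjoint B o\<^sub>L A" if "A \<in> N" for A
  proof -
    have "cadjoint A o\<^sub>L B = B o\<^sub>L cadjoint A"
      using assms that by (simp add: commutant_def)
    then have "cadjoint (cadjoint A o\<^sub>L B) = cadjoint (B o\<^sub>L cadjoint A)"
      by simp
    then show ?thesis
      using B that by (simp add: cadjoint_compose)
  qed
  then show ?thesis
    using B by (simp add: commutant_def)
qed

text \<open>Operators in the commutant map the kernel of \<open>T\<close> into itself, and so do
  their adjoints, which lie in the commutant too. Hence they commute with the orthogonal projection
  onto the kernel, and the bicommutant property puts it into \<open>N\<close>.\<close>

lemma kernel_projection:
  assumes T: "T \<in> N"
  shows "\<exists>E\<in>projections N. T o\<^sub>L E = 0 \<and> (\<forall>B :: 'h \<Rightarrow>\<^sub>L 'h. T o\<^sub>L B = 0 \<longrightarrow> E o\<^sub>L B = B)"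
proof -
  define K where "K = {x. blinfun_apply T x = 0}"
  have K_add: "x + y \<in> K" and K_diff: "x - y \<in> K" if "x \<in> K" "y \<in> K" for x y
    using that by (simp_all add: K_def blinfun.add_right blinfun.diff_right)
  have K_scale: "c *\<^sub>C x \<in> K" if "x \<in> K" for x c
    using that T by (simp add: K_def bounded_ops_scaleC)
  have "closed K"
    unfolding K_def by (intro closed_Collect_eq continuous_intros)
  moreover have "0 \<in> K"
    by (simp add: K_def)
  ultimately have "\<exists>y\<in>K. \<forall>k\<in>K. cinner (x - y) k = 0" for x
    by (intro closed_subspace_projection K_add K_scale)
  then obtain P where PK: "\<And>x. P x \<in> K" and P_orth: "\<And>x k. k \<in> K \<Longrightarrow> cinner (x - P x) k = 0"
    by metis
  \<comment> \<open>Additivity, homogeneity and commutation with the commutant all follow by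
    checking that a candidate lies in \<open>K\<close> with residual orthogonal to
    \<open>K\<close>.\<close>
  have P_unique: "P x = y" if "y \<in> K" and "\<And>k. k \<in> K \<Longrightarrow> cinner (x - y) k = 0" for x y
  proof -
    have d: "P x - y \<in> K"
      using PK that(1) by (rule K_diff)
    have "cinner (P x - y) (P x - y) = cinner (x - y) (P x - y) - cinner (x - P x) (P x - y)"
      by (simp add: cinner_diff_left)
    then have "cinner (P x - y) (P x - y) = 0"
      using that(2)[OF d] P_orth[OF d] by simp
    then show ?thesis
      by (simp add: norm_cinner)
  qed
  have P_add: "P (x + y) = P x + P y" for x y
  proof (rule P_unique)
    show "P x + P y \<in> K"
      by (intro K_add PK)
    show "cinner (x + y - (P x + P y)) k = 0" if "k \<in> K" for k
      using P_orth[OF that, of x] P_orth[OF that, of y]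
      by (simp add: cinner_diff_left cinner_add_left)
  qed
  have P_scale: "P (c *\<^sub>C x) = c *\<^sub>C P x" for c x
  proof (rule P_unique)
    show "c *\<^sub>C P x \<in> K"
      by (intro K_scale PK)
    show "cinner (c *\<^sub>C x - c *\<^sub>C P x) k = 0" if "k \<in> K" for k
      using P_orth[OF that, of x] by (simp add: cinner_scaleC_left flip: scaleC_diff_right)
  qed
  have P_norm: "norm (P x) \<le> norm x * 1" for x
  proof -
    have "(norm x)\<^sup>2 = (norm (x - P x))\<^sup>2 + (norm (P x))\<^sup>2"
      using norm_add_sq[of "x - P x" "P x"] P_orth[OF PK] by simp
    then have "(norm (P x))\<^sup>2 \<le> (norm x)\<^sup>2"
      by simp
    from power2_le_imp_le[OF this] show ?thesis
      by simp
  qed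
  have "bounded_linear P"
    by (rule bounded_linear_intro[OF P_add _ P_norm]) (simp add: scaleR_scaleC P_scale)
  then obtain E where E: "\<And>x. blinfun_apply E x = P x"
    using bounded_linear_Blinfun_apply by metis
  have P_id: "P x = x" if "x \<in> K" for x
    using that by (intro P_unique) auto
  have Eb: "E \<in> bounded_ops"
    by (simp add: bounded_ops_def E P_scale)
  have "B o\<^sub>L E = E o\<^sub>L B" if B: "B \<in> commutant N" for B
  proof (rule blinfun_eqI)
    fix x
    have Bb: "B \<in> bounded_ops"
      using B by (simp add: commutant_def)
    have inv: "blinfun_apply C k \<in> K" if "C \<in> commutant N" "k \<in> K" for C k
    proof -
      have "T o\<^sub>L C = C o\<^sub>L T"
        using that(1) T by (simp add: commutant_def)
      then have "blinfun_apply T (blinfun_apply C k) = blinfun_apply C (blinfun_apply T k)"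
        by (metis blinfun_apply_blinfun_compose)
      then show ?thesis
        using that(2) by (simp add: K_def)
    qed
    have "P (blinfun_apply B x) = blinfun_apply B (P x)"
    proof (rule P_unique)
      show "blinfun_apply B (P x) \<in> K"
        by (intro inv B PK)
      show "cinner (blinfun_apply B x - blinfun_apply B (P x)) k = 0" if "k \<in> K" for k
        using P_orth[OF inv[OF adjoint_commutant[OF B] that], of x]
        by (simp add: cinner_cadjoint[OF Bb] flip: blinfun.diff_right)
    qed
    then show "blinfun_apply (B o\<^sub>L E) x = blinfun_apply (E o\<^sub>L B) x"
      by (simp add: E)
  qed
  then have "E \<in> commutant (commutant N)"
    using Eb by (simp add: commutant_def[of "commutant N"])
  moreover have "E o\<^sub>L E = E"
    by (rule blinfun_eqI) (simp add: E P_id PK)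
  moreover have "cadjoint E = E"
  proof (rule cadjoint_unique)
    fix x y
    have "cinner (P x) (y - P y) = 0"
      using P_orth[OF PK, of y x] cinner_commute[of "P x" "y - P y"] by simp
    then show "cinner (blinfun_apply E x) y = cinner x (blinfun_apply E y)"
      using P_orth[OF PK, of x y] by (simp add: E cinner_diff_left cinner_diff_right)
  qed
  ultimately have "E \<in> projections N"
    by (simp add: projections_def bicommutant)
  moreover have "T o\<^sub>L E = 0"
    by (rule blinfun_eqI) (use PK in \<open>simp add: E K_def\<close>)
  moreover have "E o\<^sub>L B = B" if "T o\<^sub>L B = 0" for B :: "'h \<Rightarrow>\<^sub>L 'h"
  proof (rule blinfun_eqI)
    fix x
    have "blinfun_apply T (blinfun_apply B x) = 0"
      by (metis that blinfun_apply_blinfun_compose zero_blinfun.rep_eq)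
    then show "blinfun_apply (E o\<^sub>L B) x = blinfun_apply B x"
      by (simp add: E P_id K_def)
  qed
  ultimately show ?thesis
    by blast
qed

end

section \<open>Positivity, continuity and separation properties of the trace\<close>

locale tracial_von_neumann = von_neumann N
  for N :: "('h::chilbert_space \<Rightarrow>\<^sub>L 'h) set" +
  fixes \<tau> :: "('h \<Rightarrow>\<^sub>L 'h) \<Rightarrow> complex"
  assumes tracial: "faithful_tracial_state N \<tau>"
begin

lemma trace_add [simp]: "A \<in> N \<Longrightarrow> B \<in> N \<Longrightarrow> \<tau> (A + B) = \<tau> A + \<tau> B"
  and trace_scalar [simp]: "A \<in> N \<Longrightarrow> \<tau> (scalar_op c o\<^sub>L A) = c * \<tau> A"
  and trace_id [simp]: "\<tau> id_blinfun = 1"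
  and trace_commute: "A \<in> N \<Longrightarrow> B \<in> N \<Longrightarrow> \<tau> (A o\<^sub>L B) = \<tau> (B o\<^sub>L A)"
  and trace_gram: "A \<in> N \<Longrightarrow> \<tau> (cadjoint A o\<^sub>L A) \<in> \<real>\<^sub>\<ge>\<^sub>0"
  and trace_faithful: "A \<in> N \<Longrightarrow> \<tau> (cadjoint A o\<^sub>L A) = 0 \<Longrightarrow> A = 0"
proof -
  note * = tracial[unfolded faithful_tracial_state_def]
  show "A \<in> N \<Longrightarrow> B \<in> N \<Longrightarrow> \<tau> (A + B) = \<tau> A + \<tau> B"
    using *[THEN conjunct1] by simp
  show "A \<in> N \<Longrightarrow> \<tau> (scalar_op c o\<^sub>L A) = c * \<tau> A"
    using *[THEN conjunct2, THEN conjunct1] by simp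
  show "A \<in> N \<Longrightarrow> \<tau> (cadjoint A o\<^sub>L A) \<in> \<real>\<^sub>\<ge>\<^sub>0"
    using *[THEN conjunct2, THEN conjunct2, THEN conjunct1] by simp
  show "\<tau> id_blinfun = 1"
    using *[THEN conjunct2, THEN conjunct2, THEN conjunct2, THEN conjunct1] by simp
  note ** = *[THEN conjunct2, THEN conjunct2, THEN conjunct2, THEN conjunct2]
  show "A \<in> N \<Longrightarrow> B \<in> N \<Longrightarrow> \<tau> (A o\<^sub>L B) = \<tau> (B o\<^sub>L A)"
    using **[THEN conjunct1] by simp
  show "A \<in> N \<Longrightarrow> \<tau> (cadjoint A o\<^sub>L A) = 0 \<Longrightarrow> A = 0"
    using **[THEN conjunct2] by simp
qed

lemma trace_scaleR [simp]: "A \<in> N \<Longrightarrow> \<tau> (r *\<^sub>R A) = of_real r * \<tau> A"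
  by (simp add: scaleR_conv)

lemma trace_diff [simp]: "A \<in> N \<Longrightarrow> B \<in> N \<Longrightarrow> \<tau> (A - B) = \<tau> A - \<tau> B"
  using trace_add[of "A - B" B] by (simp del: trace_add)

lemma trace_sum: "(\<And>i. i \<in> I \<Longrightarrow> f i \<in> N) \<Longrightarrow> \<tau> (\<Sum>i\<in>I. f i) = (\<Sum>i\<in>I. \<tau> (f i)) \<and> (\<Sum>i\<in>I. f i) \<in> N"
  using trace_scaleR[of id_blinfun 0]
  by (induction I rule: infinite_finite_induct) auto

lemma trace_adjoint:
  assumes A: "A \<in> N"
  shows "\<tau> (cadjoint A) = cnj (\<tau> A)"
proof -
  have im: "Im (\<tau> B + \<tau> (cadjoint B)) = 0" if B: "B \<in> N" for B
  proof -
    have "cadjoint (id_blinfun + B) o\<^sub>L (id_blinfun + B)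
        = id_blinfun + B + cadjoint B + (cadjoint B o\<^sub>L B)"
      using B by (simp add: cadjoint_add ocomp.add_left ocomp.add_right algebra_simps)
    then have "\<tau> (cadjoint (id_blinfun + B) o\<^sub>L (id_blinfun + B))
        = 1 + \<tau> B + \<tau> (cadjoint B) + \<tau> (cadjoint B o\<^sub>L B)"
      using B by simp
    moreover have "Im (\<tau> (cadjoint (id_blinfun + B) o\<^sub>L (id_blinfun + B))) = 0"
      "Im (\<tau> (cadjoint B o\<^sub>L B)) = 0"
      using trace_gram[of "id_blinfun + B"] trace_gram[OF B] B
      by (auto simp: complex_nonneg_Reals_iff)
    ultimately show ?thesis
      by simp
  qed
  have "cadjoint (scalar_op \<i> o\<^sub>L A) = scalar_op (- \<i>) o\<^sub>L cadjoint A"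
    using A by (simp add: cadjoint_compose scalar_op_commute)
  then have "Im (\<i> * \<tau> A + (- \<i>) * \<tau> (cadjoint A)) = 0"
    using im[of "scalar_op \<i> o\<^sub>L A"] A by simp
  then show ?thesis
    using im[OF A] by (simp add: complex_eq_iff)
qed

lemma trace_self_adjoint:
  assumes "A \<in> N" "self_adjoint_op A"
  shows "\<tau> A = of_real (Re (\<tau> A))"
  using trace_adjoint[OF assms(1)] assms(2) by (simp add: self_adjoint_op_def complex_eq_iff)

lemma trace_cfc_nonneg:
  assumes A: "A \<in> N" "self_adjoint_op A" "real_spectrum A \<subseteq> {a..b}"
    and f: "continuous_on {a..b} f" "\<And>t. t \<in> {a..b} \<Longrightarrow> 0 \<le> f t"
  shows "0 \<le> Re (\<tau> (cfc f A))" and "\<tau> (cfc f A) = 0 \<Longrightarrow> cfc f A = 0"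
proof -
  obtain g where g: "continuous_on {a..b} g" "cfc f A = cfc g A o\<^sub>L cfc g A"
    using cfc_square_root[OF A(2,3) f] by auto
  have "cfc g A \<in> N" "cadjoint (cfc g A) = cfc g A"
    using cfc_mem_N[OF A g(1)] cfc_self_adjoint[OF A(2,3) g(1)] by (auto simp: self_adjoint_op_def)
  then show "0 \<le> Re (\<tau> (cfc f A))" "\<tau> (cfc f A) = 0 \<Longrightarrow> cfc f A = 0"
    using trace_gram[of "cfc g A"] trace_faithful[of "cfc g A"]
    by (auto simp: g(2) complex_nonneg_Reals_iff)
qed

lemma spectrum_norm_interval:
  "self_adjoint_op A \<Longrightarrow> real_spectrum A \<subseteq> {- norm A..norm A}"
  using real_spectrum_le_norm by fastforce

text \<open>Norm continuity of \<tau> comes from positivity: \<open>norm A - t\<close> is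
  nonnegative on the spectrum, so its calculus has nonnegative trace.\<close>

lemma trace_le_norm:
  assumes A: "A \<in> N" "self_adjoint_op A"
  shows "Re (\<tau> A) \<le> norm A"
proof -
  have "cfc (\<lambda>t. norm A - t) A = op_poly [:norm A, -1:] A"
    by (rule cfc_eq_poly[OF A(2) spectrum_norm_interval[OF A(2)]]) simp
  also have "\<dots> = norm A *\<^sub>R id_blinfun - A"
    by (simp add: op_poly_pCons ocomp.minus_right)
  finally have eq: "cfc (\<lambda>t. norm A - t) A = norm A *\<^sub>R id_blinfun - A" .
  have "0 \<le> Re (\<tau> (cfc (\<lambda>t. norm A - t) A))"
    by (rule trace_cfc_nonneg(1)[OF A spectrum_norm_interval[OF A(2)]]) (auto intro: continuous_intros)
  then show ?thesis
    using A by (simp add: eq)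
qed

lemma norm_trace_le:
  assumes A: "A \<in> N" "self_adjoint_op A"
  shows "cmod (\<tau> A) \<le> norm A"
proof -
  have "Re (\<tau> ((-1) *\<^sub>R A)) \<le> norm ((-1) *\<^sub>R A)"
    using A by (intro trace_le_norm scaleR_mem self_adjoint_op_scaleR)
  then have "\<bar>Re (\<tau> A)\<bar> \<le> norm A"
    using trace_le_norm[OF A] A trace_scaleR[of A "-1"] by simp
  then show ?thesis
    using trace_self_adjoint[OF A] by (metis norm_of_real)
qed

text \<open>Let H = P - M be the splitting into positive and negative part, with M P = 0. The kernel
  projection E of M satisfies E P = P and E M = 0, so \<tau>(P) = \<tau>(E H) = 0 and P = 0 by
  faithfulness. Testing with E = 1 then removes M.\<close>

lemma self_adjoint_eq_0_if_trace_projections: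
  assumes H: "H \<in> N" "self_adjoint_op H" and E0: "\<And>E. E \<in> projections N \<Longrightarrow> \<tau> (E o\<^sub>L H) = 0"
  shows "H = 0"
proof -
  note sp = spectrum_norm_interval[OF H(2)]
  let ?p = "\<lambda>t::real. max t 0" and ?m = "\<lambda>t::real. max (- t) 0"
  have cp: "continuous_on {- norm H..norm H} ?p" and cm: "continuous_on {- norm H..norm H} ?m"
    by (intro continuous_intros)+
  define P where "P = cfc ?p H"
  define M where "M = cfc ?m H"
  have PN: "P \<in> N" and MN: "M \<in> N"
    unfolding P_def M_def by (intro cfc_mem_N[OF H sp] cp cm)+
  have "cfc (\<lambda>t. ?m t * ?p t) H = op_poly 0 H"
    by (rule cfc_eq_poly[OF H(2) sp]) auto
  then have MP: "M o\<^sub>L P = 0"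
    using cfc_mult[OF H(2) sp cm cp] by (simp add: P_def M_def)
  have "cfc (\<lambda>t. ?p t - ?m t) H = op_poly [:0, 1:] H"
    by (rule cfc_eq_poly[OF H(2) sp]) auto
  then have PM: "H = P - M"
    using cfc_diff[OF H(2) sp cp cm] by (simp add: P_def M_def op_poly_pCons)
  obtain E where E: "E \<in> projections N" "M o\<^sub>L E = 0" "E o\<^sub>L P = P"
    using kernel_projection[OF MN] MP by blast
  have "cadjoint (M o\<^sub>L E) = E o\<^sub>L M"
    using E(1) MN cfc_self_adjoint[OF H(2) sp cm]
    by (simp add: cadjoint_compose projections_def self_adjoint_op_def flip: M_def)
  then have "E o\<^sub>L H = P"
    using E by (simp add: PM ocomp.diff_right)
  then have "\<tau> P = 0"
    using E0[OF E(1)] by simp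
  then have P0: "P = 0"
    unfolding P_def by (rule trace_cfc_nonneg(2)[OF H sp cp, rotated]) simp
  have "id_blinfun \<in> projections N"
    by (simp add: projections_def)
  then have "\<tau> H = 0"
    using E0 by fastforce
  then have "\<tau> M = 0"
    using PM P0 MN trace_diff[of 0 M] trace_scaleR[of id_blinfun 0] by simp
  then have "M = 0"
    unfolding M_def by (rule trace_cfc_nonneg(2)[OF H sp cm, rotated]) simp
  then show ?thesis
    using PM P0 by simp
qed

text \<open>The self-adjoint unitaries 1 and 2 E - 1 together give \<tau>(E D) = 0 for every
  projection E. Real and imaginary part of \<open>D\<close> are then treated separately.\<close>

lemma eq_0_if_trace_sa_unitaries:
  assumes D: "D \<in> N" and S: "\<And>S. S \<in> sa_unitaries N \<Longrightarrow> \<tau> (S o\<^sub>L D) = 0"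
  shows "D = 0"
proof -
  have "id_blinfun \<in> sa_unitaries N"
    by (simp add: sa_unitaries_def unitary_group_def)
  then have D0: "\<tau> D = 0"
    using S by fastforce
  have E0: "\<tau> (E o\<^sub>L D) = 0" if E: "E \<in> projections N" for E
  proof -
    have EN: "E \<in> N" "E o\<^sub>L E = E" "cadjoint E = E"
      using E by (auto simp: projections_def)
    have ad: "cadjoint (2 *\<^sub>R E - id_blinfun) = 2 *\<^sub>R E - id_blinfun"
      using EN by (simp add: cadjoint_diff cadjoint_scaleR)
    have "(2 *\<^sub>R E - id_blinfun) o\<^sub>L (2 *\<^sub>R E - id_blinfun) = id_blinfun"
      using EN by (simp add: ocomp.diff_left ocomp.diff_right ocomp.add_left ocomp.add_right
          scaleR_2)
    then have "2 *\<^sub>R E - id_blinfun \<in> sa_unitaries N"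
      using EN ad by (simp add: sa_unitaries_def unitary_group_def)
    from S[OF this] show ?thesis
      using EN D D0 by (simp add: ocomp.diff_left ocomp.scaleR_left)
  qed
  have E1: "\<tau> (E o\<^sub>L cadjoint D) = 0" if E: "E \<in> projections N" for E
  proof -
    have EN: "E \<in> N" "cadjoint E = E"
      using E by (auto simp: projections_def)
    have "\<tau> (E o\<^sub>L cadjoint D) = cnj (\<tau> (D o\<^sub>L E))"
      using EN D by (simp add: cadjoint_compose flip: trace_adjoint)
    then show ?thesis
      using E0[OF E] trace_commute[OF EN(1) D] by simp
  qed
  have PN: "E \<in> N" if "E \<in> projections N" for E
    using that by (simp add: projections_def)
  have "D + cadjoint D = 0"
  proof (rule self_adjoint_eq_0_if_trace_projections)
    show "self_adjoint_op (D + cadjoint D)"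
      using D by (simp add: self_adjoint_op_def cadjoint_add add.commute)
  qed (use D E0 E1 PN in \<open>auto simp: ocomp.add_right\<close>)
  moreover have "scalar_op \<i> o\<^sub>L (D - cadjoint D) = 0"
  proof (rule self_adjoint_eq_0_if_trace_projections)
    have "cadjoint (scalar_op \<i> o\<^sub>L (D - cadjoint D)) = (cadjoint D - D) o\<^sub>L scalar_op (- \<i>)"
      using D by (simp add: cadjoint_compose cadjoint_diff)
    also have "\<dots> = scalar_op \<i> o\<^sub>L (D - cadjoint D)"
      using D by (simp add: scalar_op_commute scalar_op_minus ocomp.minus_right ocomp.diff_left ocomp.diff_right)
    finally show "self_adjoint_op (scalar_op \<i> o\<^sub>L (D - cadjoint D))"
      using D by (simp add: self_adjoint_op_def)
    show "\<tau> (E o\<^sub>L (scalar_op \<i> o\<^sub>L (D - cadjoint D))) = 0" if E: "E \<in> projections N" for E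
    proof -
      have "E o\<^sub>L (scalar_op \<i> o\<^sub>L (D - cadjoint D)) = scalar_op \<i> o\<^sub>L ((E o\<^sub>L D) - (E o\<^sub>L cadjoint D))"
        using PN[OF E] by (simp add: scalar_op_commute ocomp.diff_right flip: ocomp_assoc)
      then show ?thesis
        using PN[OF E] D E0[OF E] E1[OF E] by simp
    qed
  qed (use D in simp)
  then have "scalar_op (- \<i>) o\<^sub>L (scalar_op \<i> o\<^sub>L (D - cadjoint D)) = 0"
    by simp
  then have "D - cadjoint D = 0"
    by (simp add: scalar_op_simps flip: ocomp_assoc)
  ultimately have "2 *\<^sub>R D = 0"
    by (simp add: scaleR_2)
  then show ?thesis
    by simp
qed

end

section \<open>Fourier coefficients of the distance function\<close>

lemma has_integral_cis_period:
  assumes "j \<noteq> 0"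
  shows "((\<lambda>\<theta>. cis (of_int j * \<theta>)) has_integral 0) {0..2 * pi}"
proof -
  let ?F = "\<lambda>\<theta>. cis (of_int j * \<theta>) / (\<i> * of_int j)"
  have "((\<lambda>\<theta>. cis (of_int j * \<theta>)) has_integral ?F (2 * pi) - ?F 0) {0..2 * pi}"
  proof (rule fundamental_theorem_of_calculus)
    fix x :: real
    have "((\<lambda>z. exp (\<i> * of_int j * z) / (\<i> * of_int j))
        has_field_derivative exp (\<i> * of_int j * complex_of_real x)) (at (complex_of_real x))"
      using assms by (auto intro!: derivative_eq_intros)
    from has_vector_derivative_real_field[OF this]
    show "(?F has_vector_derivative cis (of_int j * x)) (at x within {0..2 * pi})"
      by (simp add: cis_conv_exp mult.assoc)
  qed simp
  moreover have "cis (of_int j * (2 * pi)) = 1"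
    using cis_multiple_2pi[of "of_int j"] by (simp add: mult_ac)
  ultimately show ?thesis
    by simp
qed

text \<open>The expression is |1 - e^(i \<theta>)|^2, the scalar counterpart of
  \<open>unitary_gap\<close>; 4 is the squared diameter of the unit circle.\<close>

lemma two_minus_two_cos_range: "2 - 2 * cos \<theta> \<in> {0..4::real}"
proof -
  have "0 \<le> 2 - 2 * cos \<theta>" "2 - 2 * cos \<theta> \<le> 4"
    using cos_ge_minus_one[of \<theta>] cos_le_one[of \<theta>] by linarith+
  then show ?thesis
    by simp
qed

lemma continuous_on_two_minus_two_cos:
  fixes g :: "real \<Rightarrow> real"
  assumes "continuous_on {0..4} g"
  shows "continuous_on S (\<lambda>\<theta>. g (2 - 2 * cos \<theta>))"
  by (rule continuous_on_compose2[OF assms])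
     (use two_minus_two_cos_range in \<open>auto intro!: continuous_intros\<close>)

text \<open>Strict monotonicity of \<open>g\<close> makes the first Fourier coefficient of \<open>g(|1 - e\<^sup>i\<^sup>\<theta>|\<^sup>2)\<close> negative: subtracting
  \<open>g 2\<close> does not change it and turns the integrand \<open>(g (2 - 2 cos \<theta>) - g 2) cos \<theta>\<close> non-positive.\<close>

lemma first_Fourier_coefficient_nonzero:
  fixes g :: "real \<Rightarrow> real"
  assumes g: "continuous_on {0..4} g" and mono: "strict_mono_on {0..4} g"
  shows "integral {0..2 * pi} (\<lambda>\<theta>. cis \<theta> * g (2 - 2 * cos \<theta>)) \<noteq> 0"
proof
  assume 0: "integral {0..2 * pi} (\<lambda>\<theta>. cis \<theta> * g (2 - 2 * cos \<theta>)) = 0"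
  note range = two_minus_two_cos_range and cont = continuous_on_two_minus_two_cos[OF g]
  have "((\<lambda>\<theta>. cis \<theta> * g (2 - 2 * cos \<theta>)) has_integral 0) {0..2 * pi}"
    by (subst 0[symmetric], rule integrable_integral, rule integrable_continuous_real)
       (intro continuous_intros cont)
  from has_integral_linear[OF this bounded_linear_Re]
  have "((\<lambda>\<theta>. cos \<theta> * g (2 - 2 * cos \<theta>)) has_integral 0) {0..2 * pi}"
    by (simp add: o_def)
  moreover have "((\<lambda>\<theta>. cos \<theta>) has_integral 0) {0..2 * pi}"
    using has_integral_linear[OF has_integral_cis_period[of 1] bounded_linear_Re] by (simp add: o_def)
  ultimately have "((\<lambda>\<theta>. cos \<theta> * g 2 - cos \<theta> * g (2 - 2 * cos \<theta>)) has_integral 0 * g 2 - 0) {0..2 * pi}"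
    by (intro has_integral_diff has_integral_mult_left)
  moreover have "0 \<le> cos \<theta> * g 2 - cos \<theta> * g (2 - 2 * cos \<theta>)" for \<theta>
  proof -
    have "0 \<le> cos \<theta> * (g 2 - g (2 - 2 * cos \<theta>))"
    proof (cases "cos \<theta> \<ge> 0")
      case True
      then have "g (2 - 2 * cos \<theta>) \<le> g 2"
        using strict_mono_on_leD[OF mono range, of 2 \<theta>] by simp
      then show ?thesis
        using True by simp
    next
      case False
      then have "g 2 \<le> g (2 - 2 * cos \<theta>)"
        using strict_mono_on_leD[OF mono _ range, of 2 \<theta>] by simp
      then show ?thesis
        using False by (intro mult_nonpos_nonpos) auto
    qed
    then show ?thesis
      by (simp add: algebra_simps)
  qed
  moreover have "continuous_on {0..2 * pi} (\<lambda>\<theta>. cos \<theta> * g 2 - cos \<theta> * g (2 - 2 * cos \<theta>))"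
    by (intro continuous_intros cont)
  \<comment> \<open>A continuous nonnegative integrand with integral zero vanishes everywhere; at
    \<theta> = 0 it equals \<open>g 2 - g 0\<close>, which is positive.\<close>
  ultimately have "cos 0 * g 2 - cos 0 * g (2 - 2 * cos 0) = 0"
    using has_integral_0_cbox_imp_0[of 0 "2 * pi" "\<lambda>\<theta>. cos \<theta> * g 2 - cos \<theta> * g (2 - 2 * cos \<theta>)" 0]
      pi_gt_zero by (simp add: not_le)
  moreover have "g 0 < g 2"
    using strict_mono_onD[OF mono, of 0 2] by simp
  ultimately show False
    by simp
qed

definition unitary_power :: "('h::chilbert_space \<Rightarrow>\<^sub>L 'h) \<Rightarrow> int \<Rightarrow> ('h \<Rightarrow>\<^sub>L 'h)" where
  "unitary_power X m = (if 0 \<le> m then ((\<lambda>B. X o\<^sub>L B) ^^ nat m) id_blinfun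
     else ((\<lambda>B. cadjoint X o\<^sub>L B) ^^ nat (- m)) id_blinfun)"

lemma unitary_power_shift:
  assumes X: "cadjoint X o\<^sub>L X = id_blinfun" "X o\<^sub>L cadjoint X = id_blinfun"
  shows "X o\<^sub>L unitary_power X m = unitary_power X (m + 1)"
    and "cadjoint X o\<^sub>L unitary_power X m = unitary_power X (m - 1)"
proof -
  have X': "X o\<^sub>L (cadjoint X o\<^sub>L B) = B" "cadjoint X o\<^sub>L (X o\<^sub>L B) = B" for B
    using X by (simp_all flip: ocomp_assoc)
  show "X o\<^sub>L unitary_power X m = unitary_power X (m + 1)"
  proof (cases "0 \<le> m")
    case True
    then have "nat (m + 1) = Suc (nat m)"
      by simp
    with True show ?thesis
      by (simp add: unitary_power_def)
  next
    case False
    then have "nat (- m) = Suc (nat (- m - 1))"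
      by simp
    with False show ?thesis
      by (auto simp: unitary_power_def X X')
  qed
  show "cadjoint X o\<^sub>L unitary_power X m = unitary_power X (m - 1)"
  \<comment> \<open>The split is at \<open>0 < m\<close> here: lowering the exponent from 0 already
    enters the branch of \<open>cadjoint X\<close>.\<close>
  proof (cases "0 < m")
    case True
    then have "nat m = Suc (nat (m - 1))"
      by simp
    with True show ?thesis
      by (simp add: unitary_power_def X X')
  next
    case False
    then have "nat (- (m - 1)) = Suc (nat (- m))"
      by simp
    with False show ?thesis
      by (auto simp: unitary_power_def)
  qed
qed

text \<open>\<open>|1 - e\<^sup>-\<^sup>i\<^sup>\<theta> X|\<^sup>2\<close> for unitary \<open>X\<close>.\<close>

definition unitary_gap :: "('h::chilbert_space \<Rightarrow>\<^sub>L 'h) \<Rightarrow> real \<Rightarrow> ('h \<Rightarrow>\<^sub>L 'h)" where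
  "unitary_gap X \<theta> = 2 *\<^sub>R id_blinfun - (scalar_op (cis (- \<theta>)) o\<^sub>L X) - (scalar_op (cis \<theta>) o\<^sub>L cadjoint X)"

lemma norm_isometry_le_one:
  assumes "X \<in> bounded_ops" "cadjoint X o\<^sub>L X = id_blinfun"
  shows "norm X \<le> 1"
proof (rule norm_blinfun_bound)
  fix x
  have "cinner (blinfun_apply X x) (blinfun_apply X x) = cinner x (blinfun_apply (cadjoint X o\<^sub>L X) x)"
    by (simp add: cinner_cadjoint[OF assms(1)])
  then have "(norm (blinfun_apply X x))\<^sup>2 = (norm x)\<^sup>2"
    by (simp add: norm_sq_eq_cinner assms(2))
  then show "norm (blinfun_apply X x) \<le> 1 * norm x"
    by (simp add: power2_eq_iff_nonneg)
qed simp

text \<open>With Y = e^(-i \<theta>) X unitary, the gap is the Gram operator of 1 - Y. This gives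
  the lower end 0, and its norm is at most 2 * 2.\<close>

lemma unitary_gap_spectrum:
  assumes X: "X \<in> bounded_ops" "cadjoint X o\<^sub>L X = id_blinfun" "X o\<^sub>L cadjoint X = id_blinfun"
  shows "self_adjoint_op (unitary_gap X \<theta>)" and "real_spectrum (unitary_gap X \<theta>) \<subseteq> {0..4}"
proof -
  define Y where "Y = scalar_op (cis (- \<theta>)) o\<^sub>L X"
  have Yb: "Y \<in> bounded_ops"
    using X by (simp add: Y_def)
  have Ya: "cadjoint Y = scalar_op (cis \<theta>) o\<^sub>L cadjoint X"
    using X by (simp add: Y_def cadjoint_compose scalar_op_commute cis_cnj)
  have sc: "scalar_op (cis \<theta>) o\<^sub>L scalar_op (cis (- \<theta>)) = id_blinfun"
    "scalar_op (cis (- \<theta>)) o\<^sub>L scalar_op (cis \<theta>) = id_blinfun"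
    by (simp_all add: scalar_op_simps cis_mult)
  have YY: "cadjoint Y o\<^sub>L Y = id_blinfun" and YY': "Y o\<^sub>L cadjoint Y = id_blinfun"
    unfolding Ya unfolding Y_def using X sc
    by (simp_all add: ocomp_assoc ocomp_scalar_op_left[of X] ocomp_scalar_op_left[of "cadjoint X"])
  have gap: "unitary_gap X \<theta> = cadjoint (id_blinfun - Y) o\<^sub>L (id_blinfun - Y)"
  proof -
    have "cadjoint (id_blinfun - Y) o\<^sub>L (id_blinfun - Y) = 2 *\<^sub>R id_blinfun - Y - cadjoint Y"
      using Yb YY by (simp add: cadjoint_diff ocomp.diff_left ocomp.diff_right scaleR_2)
    then show ?thesis
      unfolding unitary_gap_def Ya[symmetric] Y_def[symmetric] by simp
  qed
  show sa: "self_adjoint_op (unitary_gap X \<theta>)"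
    unfolding gap using Yb by (simp add: self_adjoint_op_def cadjoint_compose)
  have "norm Y \<le> 1" "norm (cadjoint Y) \<le> 1"
    using norm_isometry_le_one[OF Yb YY] norm_isometry_le_one[of "cadjoint Y"] Yb YY' by auto
  then have "norm (id_blinfun - Y) \<le> 2" "norm (cadjoint (id_blinfun - Y)) \<le> 2"
    using norm_triangle_ineq4[of id_blinfun Y] norm_triangle_ineq4[of id_blinfun "cadjoint Y"]
      norm_blinfun_id_le[where 'a='a] Yb by (auto simp: cadjoint_diff)
  then have "norm (unitary_gap X \<theta>) \<le> 2 * 2"
    unfolding gap by (intro order_trans[OF norm_blinfun_compose] mult_mono) auto
  moreover have "0 \<le> t" if "t \<in> real_spectrum (unitary_gap X \<theta>)" for t
    using that Yb real_spectrum_gram_nonneg[of "id_blinfun - Y" t] by (simp add: gap)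
  ultimately show "real_spectrum (unitary_gap X \<theta>) \<subseteq> {0..4}"
    using real_spectrum_le_norm[OF sa] by fastforce
qed

context tracial_von_neumann
begin

lemma unitary_groupD:
  assumes "X \<in> unitary_group N"
  shows "X \<in> N" "cadjoint X o\<^sub>L X = id_blinfun" "X o\<^sub>L cadjoint X = id_blinfun"
  using assms by (auto simp: unitary_group_def)

lemma unitary_power_mem: "X \<in> N \<Longrightarrow> unitary_power X m \<in> N"
  by (simp add: unitary_power_def)

lemma unitary_gap_mem: "X \<in> N \<Longrightarrow> unitary_gap X \<theta> \<in> N"
  by (simp add: unitary_gap_def)

text \<open>Each factor \<open>2 - e\<^sup>-\<^sup>i\<^sup>\<theta> X - e\<^sup>i\<^sup>\<theta> X\<^sup>*\<close> shifts \<open>m\<close> and \<open>j\<close> by one in opposite directions, so the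
  induction needs all \<open>m\<close> and \<open>j\<close> although only \<open>m = 0\<close>, \<open>j = 1\<close> is of interest.\<close>

lemma trace_gap_power_Fourier:
  assumes X: "X \<in> unitary_group N"
  shows "((\<lambda>\<theta>. cis (of_int j * \<theta>) * \<tau> (((\<lambda>B. unitary_gap X \<theta> o\<^sub>L B) ^^ k) id_blinfun o\<^sub>L unitary_power X m))
    has_integral \<tau> (unitary_power X (m + j)) *
      integral {0..2 * pi} (\<lambda>\<theta>. cis (of_int j * \<theta>) * (2 - 2 * cos \<theta>) ^ k)) {0..2 * pi}"
proof (induction k arbitrary: j m)
  case 0
  show ?case
  proof (cases "j = 0")
    case True
    then show ?thesis
      using has_integral_const_real[of "\<tau> (unitary_power X m)" 0 "2 * pi"]
      by (simp add: scaleR_conv_of_real mult.commute)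
  next
    case False
    from has_integral_mult_left[OF has_integral_cis_period[OF this], of "\<tau> (unitary_power X m)"]
    show ?thesis
      using integral_unique[OF has_integral_cis_period[OF False]] by simp
  qed
next
  case (Suc k)
  note X' = unitary_groupD[OF X]
  define G where "G \<theta> = ((\<lambda>B. unitary_gap X \<theta> o\<^sub>L B) ^^ k) id_blinfun" for \<theta>
  define I where "I k j = integral {0..2 * pi} (\<lambda>\<theta>. cis (of_int j * \<theta>) * (2 - 2 * cos \<theta>) ^ k)"
    for k :: nat and j :: int
  have GN: "G \<theta> \<in> N" for \<theta>
    unfolding G_def by (intro funpow_mem unitary_gap_mem X')
  \<comment> \<open>\<open>G \<theta>\<close> is a polynomial in the gap, so the new factor can be
    moved next to the power of \<open>X\<close>, where the shift rules apply.\<close>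
  have comm: "unitary_gap X \<theta> o\<^sub>L G \<theta> = G \<theta> o\<^sub>L unitary_gap X \<theta>" for \<theta>
    using op_poly_commute[of "unitary_gap X \<theta>" "monom 1 k"]
    unfolding G_def op_poly_monom .
  have cis_shift: "cis (of_int j * \<theta>) * cis (- \<theta>) = cis (of_int (j - 1) * \<theta>)"
    "cis (of_int j * \<theta>) * cis \<theta> = cis (of_int (j + 1) * \<theta>)" for \<theta>
    by (simp_all add: cis_mult algebra_simps)
  have split: "\<tau> (((\<lambda>B. unitary_gap X \<theta> o\<^sub>L B) ^^ Suc k) id_blinfun o\<^sub>L unitary_power X m)
      = 2 * \<tau> (G \<theta> o\<^sub>L unitary_power X m) - cis (- \<theta>) * \<tau> (G \<theta> o\<^sub>L unitary_power X (m + 1))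
        - cis \<theta> * \<tau> (G \<theta> o\<^sub>L unitary_power X (m - 1))" for \<theta>
  proof -
    have sc: "G \<theta> o\<^sub>L (scalar_op c o\<^sub>L B) = scalar_op c o\<^sub>L (G \<theta> o\<^sub>L B)" for c B
      using GN by (simp add: ocomp_scalar_op_left)
    have "((\<lambda>B. unitary_gap X \<theta> o\<^sub>L B) ^^ Suc k) id_blinfun o\<^sub>L unitary_power X m
        = G \<theta> o\<^sub>L (unitary_gap X \<theta> o\<^sub>L unitary_power X m)"
      using comm[of \<theta>] by (simp add: G_def flip: ocomp_assoc)
    also have "\<dots> = 2 *\<^sub>R (G \<theta> o\<^sub>L unitary_power X m)
        - (scalar_op (cis (- \<theta>)) o\<^sub>L (G \<theta> o\<^sub>L unitary_power X (m + 1)))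
        - (scalar_op (cis \<theta>) o\<^sub>L (G \<theta> o\<^sub>L unitary_power X (m - 1)))"
      using unitary_power_shift[OF X'(2,3), of m]
      by (simp add: unitary_gap_def ocomp.diff_left ocomp.diff_right ocomp.scaleR_left
          ocomp.scaleR_right ocomp_assoc sc)
    finally show ?thesis
      using GN X' by (simp add: unitary_power_mem)
  qed
  have int: "(\<lambda>\<theta>. cis (of_int j * \<theta>) * (2 - 2 * cos \<theta>) ^ k) integrable_on {0..2 * pi}" for j :: int
    by (rule integrable_continuous_real) (intro continuous_intros)
  have "((\<lambda>\<theta>. 2 * (cis (of_int j * \<theta>) * (2 - 2 * cos \<theta>) ^ k)
      - cis (of_int (j - 1) * \<theta>) * (2 - 2 * cos \<theta>) ^ k
      - cis (of_int (j + 1) * \<theta>) * (2 - 2 * cos \<theta>) ^ k)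
      has_integral 2 * I k j - I k (j - 1) - I k (j + 1)) {0..2 * pi}"
    unfolding I_def by (intro has_integral_diff has_integral_mult_right integrable_integral int)
  moreover have "2 * (cis (of_int j * \<theta>) * (2 - 2 * cos \<theta>) ^ k)
      - cis (of_int (j - 1) * \<theta>) * (2 - 2 * cos \<theta>) ^ k
      - cis (of_int (j + 1) * \<theta>) * (2 - 2 * cos \<theta>) ^ k
      = cis (of_int j * \<theta>) * (2 - 2 * cos \<theta>) ^ Suc k" for \<theta>
  proof -
    have gap: "complex_of_real (2 - 2 * cos \<theta>) = 2 - cis (- \<theta>) - cis \<theta>"
      by (simp add: complex_eq_iff)
    show ?thesis
      unfolding cis_shift[symmetric] power_Suc of_real_mult gap by (simp add: algebra_simps)
  qed
  ultimately have I_Suc: "I (Suc k) j = 2 * I k j - I k (j - 1) - I k (j + 1)"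
    unfolding I_def[of "Suc k"] by (intro integral_unique) simp
  \<comment> \<open>In all three terms the exponents add up to m + j, so the same trace factors out
    and leaves the scalar recurrence \<open>I_Suc\<close>.\<close>
  have "((\<lambda>\<theta>. 2 * (cis (of_int j * \<theta>) * \<tau> (G \<theta> o\<^sub>L unitary_power X m))
      - cis (of_int (j - 1) * \<theta>) * \<tau> (G \<theta> o\<^sub>L unitary_power X (m + 1))
      - cis (of_int (j + 1) * \<theta>) * \<tau> (G \<theta> o\<^sub>L unitary_power X (m - 1)))
      has_integral 2 * (\<tau> (unitary_power X (m + j)) * I k j)
        - \<tau> (unitary_power X (m + 1 + (j - 1))) * I k (j - 1)
        - \<tau> (unitary_power X (m - 1 + (j + 1))) * I k (j + 1)) {0..2 * pi}"
    unfolding G_def I_def by (intro has_integral_diff has_integral_mult_right Suc.IH)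
  then have "((\<lambda>\<theta>. 2 * (cis (of_int j * \<theta>) * \<tau> (G \<theta> o\<^sub>L unitary_power X m))
      - cis (of_int (j - 1) * \<theta>) * \<tau> (G \<theta> o\<^sub>L unitary_power X (m + 1))
      - cis (of_int (j + 1) * \<theta>) * \<tau> (G \<theta> o\<^sub>L unitary_power X (m - 1)))
      has_integral \<tau> (unitary_power X (m + j)) * I (Suc k) j) {0..2 * pi}"
    by (simp add: I_Suc algebra_simps)
  moreover have "2 * (cis (of_int j * \<theta>) * \<tau> (G \<theta> o\<^sub>L unitary_power X m))
      - cis (of_int (j - 1) * \<theta>) * \<tau> (G \<theta> o\<^sub>L unitary_power X (m + 1))
      - cis (of_int (j + 1) * \<theta>) * \<tau> (G \<theta> o\<^sub>L unitary_power X (m - 1))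
      = cis (of_int j * \<theta>) * \<tau> (((\<lambda>B. unitary_gap X \<theta> o\<^sub>L B) ^^ Suc k) id_blinfun o\<^sub>L unitary_power X m)" for \<theta>
    unfolding split cis_shift[symmetric] by (simp add: algebra_simps)
  ultimately show ?case
    unfolding I_def by simp
qed

text \<open>The convolution identity at the first Fourier coefficient for a polynomial profile,
  obtained from the monomials by linearity with m = 0 and j = 1.\<close>

lemma trace_gap_poly_Fourier:
  assumes X: "X \<in> unitary_group N"
  shows "((\<lambda>\<theta>. cis \<theta> * \<tau> (op_poly r (unitary_gap X \<theta>)))
    has_integral \<tau> X * integral {0..2 * pi} (\<lambda>\<theta>. cis \<theta> * poly r (2 - 2 * cos \<theta>))) {0..2 * pi}"
proof -
  note X' = unitary_groupD[OF X]
  define I where "I k = integral {0..2 * pi} (\<lambda>\<theta>. cis \<theta> * (2 - 2 * cos \<theta>) ^ k)" for k :: nat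
  have up: "unitary_power X 0 = id_blinfun" "unitary_power X 1 = X"
    by (simp_all add: unitary_power_def)
  have pow: "((\<lambda>\<theta>. cis \<theta> * \<tau> (((\<lambda>B. unitary_gap X \<theta> o\<^sub>L B) ^^ k) id_blinfun))
      has_integral \<tau> X * I k) {0..2 * pi}" for k
    using trace_gap_power_Fourier[OF X, of 1 k 0] by (simp add: up I_def)
  have "((\<lambda>\<theta>. \<Sum>i\<le>degree r. coeff r i * (cis \<theta> * \<tau> (((\<lambda>B. unitary_gap X \<theta> o\<^sub>L B) ^^ i) id_blinfun)))
      has_integral (\<Sum>i\<le>degree r. coeff r i * (\<tau> X * I i))) {0..2 * pi}"
    by (intro has_integral_sum has_integral_mult_right pow) simp
  moreover have "(\<Sum>i\<le>degree r. coeff r i * (cis \<theta> * \<tau> (((\<lambda>B. unitary_gap X \<theta> o\<^sub>L B) ^^ i) id_blinfun)))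
      = cis \<theta> * \<tau> (op_poly r (unitary_gap X \<theta>))" for \<theta>
  proof -
    have "\<tau> (op_poly r (unitary_gap X \<theta>))
        = (\<Sum>i\<le>degree r. coeff r i * \<tau> (((\<lambda>B. unitary_gap X \<theta> o\<^sub>L B) ^^ i) id_blinfun))"
      unfolding op_poly_def using X'
      by (subst trace_sum[THEN conjunct1]) (simp_all add: unitary_gap_mem)
    then show ?thesis
      by (simp add: sum_distrib_left mult_ac)
  qed
  moreover have "((\<lambda>\<theta>. \<Sum>i\<le>degree r. coeff r i * (cis \<theta> * (2 - 2 * cos \<theta>) ^ i))
      has_integral (\<Sum>i\<le>degree r. coeff r i * I i)) {0..2 * pi}"
    unfolding I_def
    by (intro has_integral_sum has_integral_mult_right integrable_integral integrable_continuous_real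
        continuous_intros) simp
  then have "integral {0..2 * pi} (\<lambda>\<theta>. cis \<theta> * poly r (2 - 2 * cos \<theta>)) = (\<Sum>i\<le>degree r. coeff r i * I i)"
    by (intro integral_unique) (simp add: poly_altdef sum_distrib_left mult_ac)
  ultimately show ?thesis
    by (simp add: sum_distrib_left mult_ac)
qed

text \<open>For a polynomial q within e of g, the traces of q at the two gaps differ by at most 2 e.
  Integrating, \<tau>(X) - \<tau>(Y) times the first coefficient of q is of order e, and that
  coefficient is within order e of the nonzero one of g.\<close>

lemma trace_eq_if_gap_trace_eq:
  fixes g :: "real \<Rightarrow> real"
  assumes X: "X \<in> unitary_group N" and Y: "Y \<in> unitary_group N"
    and g: "continuous_on {0..4} g" and mono: "strict_mono_on {0..4} g"
    and eq: "\<And>\<theta>. Re (\<tau> (cfc g (unitary_gap X \<theta>))) = Re (\<tau> (cfc g (unitary_gap Y \<theta>)))"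
  shows "\<tau> X = \<tau> Y"
proof (rule ccontr)
  assume ne: "\<tau> X \<noteq> \<tau> Y"
  define c where "c = integral {0..2 * pi} (\<lambda>\<theta>. cis \<theta> * g (2 - 2 * cos \<theta>))"
  define d where "d = \<tau> X - \<tau> Y"
  have "c \<noteq> 0"
    unfolding c_def by (rule first_Fourier_coefficient_nonzero[OF g mono])
  \<comment> \<open>Collects 2 e (2 \<pi>) from the traces and |d| e (2 \<pi>) from replacing the
    coefficient of \<open>q\<close> by that of \<open>g\<close>.\<close>
  define K where "K = 2 * pi * (2 + cmod d)"
  have "K > 0"
    by (simp add: K_def add_pos_nonneg)
  have bound: "cmod (d * c) \<le> K * e" if "e > 0" for e
  proof -
    obtain q where q: "\<And>t. t \<in> {0..4} \<Longrightarrow> \<bar>g t - poly q t\<bar> \<le> e"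
    proof -
      obtain p where "uniform_limit {0..4} (\<lambda>n. poly (p n)) g sequentially"
        using poly_approx[OF g] by blast
      from uniform_limitD[OF this \<open>e > 0\<close>]
      obtain n where "\<forall>t\<in>{0..4}. dist (poly (p n) t) (g t) < e"
        unfolding eventually_sequentially by blast
      then have "\<bar>g t - poly (p n) t\<bar> \<le> e" if "t \<in> {0..4}" for t
        using that unfolding dist_real_def by (simp add: abs_minus_commute less_imp_le)
      then show thesis
        using that by blast
    qed
    have near: "cmod (of_real (Re (\<tau> (cfc g (unitary_gap Z \<theta>)))) - \<tau> (op_poly q (unitary_gap Z \<theta>))) \<le> e"
      if Z: "Z \<in> unitary_group N" for Z \<theta>
    proof -
      note Z' = unitary_groupD[OF Z]
      note sp = unitary_gap_spectrum[OF bounded_mem[OF Z'(1)] Z'(2,3), of \<theta>]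
      note mem = unitary_gap_mem[OF Z'(1), of \<theta>]
      have cN: "cfc g (unitary_gap Z \<theta>) \<in> N" and cS: "self_adjoint_op (cfc g (unitary_gap Z \<theta>))"
        by (intro cfc_mem_N[OF mem sp g] cfc_self_adjoint[OF sp g])+
      have "cmod (\<tau> (cfc g (unitary_gap Z \<theta>) - op_poly q (unitary_gap Z \<theta>)))
          \<le> norm (cfc g (unitary_gap Z \<theta>) - op_poly q (unitary_gap Z \<theta>))"
        by (intro norm_trace_le diff_mem cN op_poly_mem mem self_adjoint_op_diff cS
            self_adjoint_op_poly sp(1))
      also have "\<dots> \<le> e"
        using \<open>e > 0\<close> by (intro norm_cfc_diff_poly_le[OF sp g q]) auto
      finally show ?thesis
        using trace_self_adjoint[OF cN cS] cN mem by simp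
    qed
    have close: "cmod (cis \<theta> * \<tau> (op_poly q (unitary_gap X \<theta>)) - cis \<theta> * \<tau> (op_poly q (unitary_gap Y \<theta>)))
        \<le> 2 * e" for \<theta>
    proof -
      define a where "a = \<tau> (op_poly q (unitary_gap X \<theta>))"
      define b where "b = \<tau> (op_poly q (unitary_gap Y \<theta>))"
      \<comment> \<open>By \<open>eq\<close> this one real number is the common reference point for
        both gaps, within e of \<open>a\<close> and of \<open>b\<close>.\<close>
      define u where "u = complex_of_real (Re (\<tau> (cfc g (unitary_gap Y \<theta>))))"
      have "cmod (u - a) \<le> e" "cmod (u - b) \<le> e"
        using near[OF X, of \<theta>] near[OF Y, of \<theta>] by (simp_all add: eq a_def b_def u_def)
      then have "cmod (a - b) \<le> 2 * e"
        using norm_triangle_ineq4[of "u - b" "u - a"] by simp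
      then show ?thesis
        by (simp add: a_def b_def norm_mult flip: right_diff_distrib)
    qed
    define cq where "cq = integral {0..2 * pi} (\<lambda>\<theta>. cis \<theta> * poly q (2 - 2 * cos \<theta>))"
    note range = two_minus_two_cos_range and cont = continuous_on_two_minus_two_cos[OF g]
    have 1: "cmod (\<tau> X * cq - \<tau> Y * cq) \<le> 2 * e * (2 * pi)"
    proof -
      have "cmod (\<tau> X * cq - \<tau> Y * cq) \<le> (2 * e) * measure lborel {0..2 * pi}"
        unfolding cq_def using \<open>e > 0\<close>
        by (intro has_integral_bound_real[OF _ finite.emptyI
              has_integral_diff[OF trace_gap_poly_Fourier[OF X] trace_gap_poly_Fourier[OF Y]]] close) simp
      then show ?thesis
        by simp
    qed
    have "((\<lambda>\<theta>. cis \<theta> * poly q (2 - 2 * cos \<theta>) - cis \<theta> * g (2 - 2 * cos \<theta>)) has_integral cq - c) {0..2 * pi}"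
      unfolding cq_def c_def
      by (intro has_integral_diff integrable_integral integrable_continuous_real continuous_intros cont)
    moreover have "cmod (cis \<theta> * poly q (2 - 2 * cos \<theta>) - cis \<theta> * g (2 - 2 * cos \<theta>)) \<le> e" for \<theta>
    proof -
      have "cis \<theta> * poly q (2 - 2 * cos \<theta>) - cis \<theta> * g (2 - 2 * cos \<theta>)
          = cis \<theta> * of_real (poly q (2 - 2 * cos \<theta>) - g (2 - 2 * cos \<theta>))"
        by (simp add: right_diff_distrib)
      then show ?thesis
        using q[OF range[of \<theta>]] by (simp only: norm_mult norm_cis norm_of_real) (simp add: abs_minus_commute)
    qed
    ultimately have "cmod (cq - c) \<le> e * measure lborel {0..2 * pi}"
      by (rule has_integral_bound_real[OF less_imp_le[OF \<open>e > 0\<close>] finite.emptyI])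
    then have 2: "cmod (cq - c) \<le> e * (2 * pi)"
      by simp
    have "d * c = (\<tau> X * cq - \<tau> Y * cq) - d * (cq - c)"
      by (simp add: d_def algebra_simps)
    then have "cmod (d * c) \<le> cmod (\<tau> X * cq - \<tau> Y * cq) + cmod d * cmod (cq - c)"
      by (metis norm_mult norm_triangle_ineq4)
    also have "\<dots> \<le> 2 * e * (2 * pi) + cmod d * (e * (2 * pi))"
      by (intro add_mono 1 mult_left_mono 2) simp
    also have "\<dots> = K * e"
      by (simp add: K_def algebra_simps)
    finally show ?thesis .
  qed
  have "cmod (d * c) > 0"
    using ne \<open>c \<noteq> 0\<close> by (simp add: d_def)
  \<comment> \<open>This choice of e bounds |d c| by half of itself.\<close>
  then show False
    using bound[of "cmod (d * c) / (2 * K)"] \<open>K > 0\<close> by simp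
qed

text \<open>The second claim is recorded because the outer power 1/p can be undone only over a
  nonnegative base; the third because the Fourier argument applies to unitaries.\<close>

lemma Lp_norm_unitary_diff:
  assumes W: "W \<in> unitary_group N" and S: "S \<in> sa_unitaries N" and "0 < p"
  shows "Lp_norm \<tau> p (W - (scalar_op (cis \<theta>) o\<^sub>L S))
      = Re (\<tau> (cfc (\<lambda>t. t powr (p / 2)) (unitary_gap (S o\<^sub>L W) \<theta>))) powr (1 / p)"
    and "0 \<le> Re (\<tau> (cfc (\<lambda>t. t powr (p / 2)) (unitary_gap (S o\<^sub>L W) \<theta>)))"
    and "S o\<^sub>L W \<in> unitary_group N"
proof -
  note W' = unitary_groupD[OF W]
  have S': "S \<in> N" "S o\<^sub>L S = id_blinfun" "cadjoint S = S"
    using S by (auto simp: sa_unitaries_def unitary_group_def)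
  have SS: "S o\<^sub>L (S o\<^sub>L B) = B" and WW: "cadjoint W o\<^sub>L (W o\<^sub>L B) = B" "W o\<^sub>L (cadjoint W o\<^sub>L B) = B"
    for B :: "'h \<Rightarrow>\<^sub>L 'h"
    using S'(2) W'(2,3) by (simp_all flip: ocomp_assoc)
  have ad: "cadjoint (S o\<^sub>L W) = cadjoint W o\<^sub>L S"
    using S' W' by (simp add: cadjoint_compose)
  show U: "S o\<^sub>L W \<in> unitary_group N"
    using S' W' by (simp add: unitary_group_def ad ocomp_assoc SS WW)
  note sp = unitary_gap_spectrum[OF bounded_mem[OF unitary_groupD(1)[OF U]] unitary_groupD(2,3)[OF U], of \<theta>]
  have ad': "cadjoint (W - (scalar_op (cis \<theta>) o\<^sub>L S)) = cadjoint W - (scalar_op (cis (- \<theta>)) o\<^sub>L S)"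
    using S' W' by (simp add: cadjoint_diff cadjoint_compose scalar_op_commute cis_cnj)
  have cis: "scalar_op (cis (- \<theta>)) o\<^sub>L scalar_op (cis \<theta>) = id_blinfun"
    by (simp add: scalar_op_simps cis_mult)
  have "cadjoint (W - (scalar_op (cis \<theta>) o\<^sub>L S)) o\<^sub>L (W - (scalar_op (cis \<theta>) o\<^sub>L S))
      = unitary_gap (S o\<^sub>L W) \<theta>"
    using S' W' unfolding ad' unitary_gap_def ad
    by (simp add: ocomp.diff_left ocomp.diff_right ocomp_assoc ocomp_scalar_op_left[of S]
        ocomp_scalar_op_left[of "cadjoint W"] cis scaleR_2)
  then show "Lp_norm \<tau> p (W - (scalar_op (cis \<theta>) o\<^sub>L S))
      = Re (\<tau> (cfc (\<lambda>t. t powr (p / 2)) (unitary_gap (S o\<^sub>L W) \<theta>))) powr (1 / p)"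
    unfolding Lp_norm_def abs_op_def using cfc_powr_sqrt[OF sp \<open>0 < p\<close>] by simp
  show "0 \<le> Re (\<tau> (cfc (\<lambda>t. t powr (p / 2)) (unitary_gap (S o\<^sub>L W) \<theta>)))"
    using \<open>0 < p\<close>
    by (intro trace_cfc_nonneg(1)[OF unitary_gap_mem[OF unitary_groupD(1)[OF U]] sp]
        continuous_on_powr_nonneg) auto
qed

lemma unitary_eq_if_Lp_distances_eq:
  assumes W: "W \<in> unitary_group N" and Z: "Z \<in> unitary_group N" and "0 < p"
    and dist: "\<And>S \<theta>. S \<in> sa_unitaries N \<Longrightarrow>
      Lp_norm \<tau> p (W - (scalar_op (cis \<theta>) o\<^sub>L S)) = Lp_norm \<tau> p (Z - (scalar_op (cis \<theta>) o\<^sub>L S))"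
  shows "W = Z"
proof -
  \<comment> \<open>The profile is t^(p/2), a function of the squared modulus; its strict growth is
    what keeps the first Fourier coefficient away from zero.\<close>
  have mono: "strict_mono_on {0..4} (\<lambda>t::real. t powr (p / 2))"
    using \<open>0 < p\<close> by (intro strict_mono_onI powr_less_mono2) auto
  have "\<tau> (S o\<^sub>L (W - Z)) = 0" if S: "S \<in> sa_unitaries N" for S
  proof -
    have "\<tau> (S o\<^sub>L W) = \<tau> (S o\<^sub>L Z)"
    proof (rule trace_eq_if_gap_trace_eq[OF _ _ _ mono])
      fix \<theta>
      let ?a = "Re (\<tau> (cfc (\<lambda>t. t powr (p / 2)) (unitary_gap (S o\<^sub>L W) \<theta>)))"
      let ?b = "Re (\<tau> (cfc (\<lambda>t. t powr (p / 2)) (unitary_gap (S o\<^sub>L Z) \<theta>)))"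
      note Wn = Lp_norm_unitary_diff(1,2)[OF W S \<open>0 < p\<close>, of \<theta>]
        and Zn = Lp_norm_unitary_diff(1,2)[OF Z S \<open>0 < p\<close>, of \<theta>]
      have "?a powr (1 / p) = ?b powr (1 / p)"
        using dist[OF S, of \<theta>] unfolding Wn(1) Zn(1) .
      then have "(?a powr (1 / p)) powr p = (?b powr (1 / p)) powr p"
        by simp
      then show "?a = ?b"
        using \<open>0 < p\<close> Wn(2) Zn(2) by (simp add: powr_powr)
    qed (use Lp_norm_unitary_diff(3) W Z S \<open>0 < p\<close> continuous_on_powr_nonneg in auto)
    moreover have "S \<in> N"
      using S by (simp add: sa_unitaries_def unitary_group_def)
    ultimately show ?thesis
      using unitary_groupD(1)[OF W] unitary_groupD(1)[OF Z] by (simp add: ocomp.diff_right)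
  qed
  then have "W - Z = 0"
    using unitary_groupD(1)[OF W] unitary_groupD(1)[OF Z] by (intro eq_0_if_trace_sa_unitaries) auto
  then show ?thesis
    by simp
qed

lemma unitary_group_compose:
  assumes "X \<in> unitary_group N" "Y \<in> unitary_group N"
  shows "X o\<^sub>L Y \<in> unitary_group N"
proof -
  note X = unitary_groupD[OF assms(1)] and Y = unitary_groupD[OF assms(2)]
  have "cadjoint X o\<^sub>L (X o\<^sub>L B) = B" "Y o\<^sub>L (cadjoint Y o\<^sub>L B) = B" for B :: "'h \<Rightarrow>\<^sub>L 'h"
    using X Y by (simp_all flip: ocomp_assoc)
  then show ?thesis
    using X Y by (simp add: unitary_group_def cadjoint_compose ocomp_assoc)
qed

lemma scalar_op_cis_unitary: "scalar_op (cis \<theta>) \<in> unitary_group N"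
  by (simp add: unitary_group_def scalar_op_simps cis_cnj cis_mult)

end

theorem lemma2p8:
  fixes N :: "('h::chilbert_space \<Rightarrow>\<^sub>L 'h) set"
    and \<tau> :: "('h \<Rightarrow>\<^sub>L 'h) \<Rightarrow> complex"
    and \<psi> :: "('h \<Rightarrow>\<^sub>L 'h) \<Rightarrow> ('h \<Rightarrow>\<^sub>L 'h)"
    and p :: real
  assumes "0 < p" and "p \<noteq> 2"
    and "II1_factor N"
    and "faithful_tracial_state N \<tau>"
    and "Lp_isometry N \<tau> p \<psi>"
    and "\<psi> ` unitary_group N = unitary_group N"
    and "\<And>U \<theta>. U \<in> sa_unitaries N \<Longrightarrow> \<psi> (scalar_op (cis \<theta>) o\<^sub>L U) = scalar_op (cis \<theta>) o\<^sub>L U"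
  shows "\<forall>U\<in>sa_unitaries N. \<forall>V\<in>sa_unitaries N. \<forall>\<theta>::real.
           \<psi> (scalar_op (cis \<theta>) o\<^sub>L U o\<^sub>L V) = scalar_op (cis \<theta>) o\<^sub>L U o\<^sub>L V"
proof (intro ballI allI)
  fix U V \<theta>
  assume UV: "U \<in> sa_unitaries N" "V \<in> sa_unitaries N"
  interpret tracial_von_neumann N \<tau>
    using assms(3,4) by unfold_locales (auto simp: II1_factor_def vn_factor_def)
  let ?W = "scalar_op (cis \<theta>) o\<^sub>L U o\<^sub>L V"
  have sa: "S \<in> unitary_group N" if "S \<in> sa_unitaries N" for S
    using that by (simp add: sa_unitaries_def)
  have W: "?W \<in> unitary_group N"
    by (intro unitary_group_compose scalar_op_cis_unitary sa UV)
  have \<psi>W: "\<psi> ?W \<in> unitary_group N"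
    using W assms(6) by blast
  show "\<psi> ?W = ?W"
  proof (rule unitary_eq_if_Lp_distances_eq[OF \<psi>W W \<open>0 < p\<close>])
    fix S \<phi>
    assume S: "S \<in> sa_unitaries N"
    have "scalar_op (cis \<phi>) o\<^sub>L S \<in> unitary_group N"
      by (intro unitary_group_compose scalar_op_cis_unitary sa S)
    \<comment> \<open>The isometry property is used for the pair of \<open>?W\<close> and
      \<open>scalar_op (cis \<phi>) o\<^sub>L S\<close>, the second of which \<psi> fixes.\<close>
    then show "Lp_norm \<tau> p (\<psi> ?W - (scalar_op (cis \<phi>) o\<^sub>L S)) = Lp_norm \<tau> p (?W - (scalar_op (cis \<phi>) o\<^sub>L S))"
      using assms(5) W assms(7)[OF S, of \<phi>] unfolding Lp_isometry_def by metis
  qed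
qed

end
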